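(* Assume A1 (the Hessian of $f$ is $L$-Lipschitz). Let $\{x_k\}_{k\ge 1}$ be generated by the algorithm First-Order CNM (described in the context) with inputs $x_0\in Q$, $\tau_0>0$, $\epsilon>0$, $m\in\mathbb{N}\setminus\{0\}$. Let $T(\epsilon)\le+\infty$ be the first iteration index such that $$\|\nabla f(x_{T(\epsilon)})+\psi'(x_{T(\epsilon)})\|\le\epsilon\quad\text{for a certain }\psi'(x_{T(\epsilon)})\in\partial\psi(x_{T(\epsilon)}).$$ Then $$T(\epsilon)\;\le\;\frac{384\cdot 2^{5/2}\,(2/3)^{1/6}\,\max\{\tau_0,L\}^{1/2}\,(F(x_0)-F^\star)}{\sqrt m}\,\epsilon^{-3/2},$$ and, consequently, the total number $\mathrm{FO}_{T(\epsilon)}$ of function and gradient evaluations of $f$ performed during the first $T(\epsilon)$ iterations satisfies $$\mathrm{FO}_{T(\epsilon)}\;\le\;\frac{5+2(n+m)}{\sqrt m}\cdot 384\cdot 2^{5/2}\Bigl(\frac23\Bigr)^{1/6}\max\{\tau_0,L\}^{1/2}(F(x_0)-F^\star)\,\epsilon^{-3/2}+(2+n+m)\log_2\frac{\max\{\tau_0,L\}}{\tau_0}.$$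
   Context: Setting: $\|\cdot\|$ is the Euclidean norm for vectors and the spectral norm for matrices; $e_1,\dots,e_n$ is the standard basis of $\mathbb{R}^n$. $f:\mathbb{R}^n\to\mathbb{R}$ is twice continuously differentiable (possibly non-convex), $\psi:\mathbb{R}^n\to\mathbb{R}\cup\{+\infty\}$ is proper, closed and convex (possibly non-differentiable), $Q=\operatorname{dom}\psi$, $F=f+\psi$, and $F^\star=\inf_{x\in Q}F(x)>-\infty$. Assumption A1: $\|\nabla^2 f(y)-\nabla^2 f(x)\|\le L\|y-x\|$ for all $x,y\in\mathbb{R}^n$, where $L\ge 0$. Procedure CubicSteps$(x,B,\sigma,m,\epsilon)$ ($x\in Q$, $B=B^\top\in\mathbb{R}^{n\times n}$, $\sigma>0$, $m\ge1$, $\epsilon>0$): Step 0: set $x_0:=x$, $t:=0$. Step 1: if $t=m$, stop and return $(x_t,\text{success})$. Step 2: with $M_{x_t,\sigma}(y)=f(x_t)+\langle\nabla f(x_t),y-x_t\rangle+\frac12\langle B(y-x_t),y-x_t\rangle+\frac{\sigma}{6}\|y-x_t\|^3$, compute $x_{t+1}\in Q$ as an approximate minimizer of $M_{x_t,\sigma}+\psi$ over $Q$ such that $M_{x_t,\sigma}(x_{t+1})+\psi(x_{t+1})\le F(x_t)$ and $\|\nabla M_{x_t,\sigma}(x_{t+1})+\psi'(x_{t+1})\|\le\frac{\sigma}{4}\|x_{t+1}-x_t\|^2$ for some $\psi'(x_{t+1})\in\partial\psi(x_{t+1})$. Step 3: if $\|\nabla f(x_{t+1})+\psi'(x_{t+1})\|\le\epsilon$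 (same subgradient), stop and return $(x_{t+1},\text{solution})$. Step 4: if $F(x_0)-F(x_{t+1})\ge\frac{\epsilon^{3/2}}{384\,\sigma^{1/2}}(t+1)$, set $t:=t+1$ and go to Step 1; otherwise stop and return $(x_{t+1},\text{halt})$. Algorithm First-Order CNM: Step 0: given $x_0\in Q$, $\tau_0>0$, $\epsilon>0$, $m\ge1$, set $k:=0$. Step 1: set $\ell:=0$. Step 1.1: with $\sigma_{k,\ell}=2^4(2/3)^{1/3}(2^\ell\tau_k)m$ and $h_{k,\ell}=\Bigl[\frac{3\,\sigma_{k,\ell}^{3/2}\epsilon^{3/2}}{2^7\cdot192\,n^{3/2}(2^\ell\tau_k)^3}\Bigr]^{1/3}$, compute $B_{k,\ell}=\frac12(A_{k,\ell}+A_{k,\ell}^\top)$, where the $i$-th column of $A_{k,\ell}$ is $\frac{\nabla f(x_k+h_{k,\ell}e_i)-\nabla f(x_k)}{h_{k,\ell}}$. Step 1.2: $(\hat x_{k,\ell},\alpha_{k,\ell}):=$ CubicSteps$(x_k,B_{k,\ell},\sigma_{k,\ell},m,\epsilon)$. Step 2: if $\alpha_{k,\ell}=\text{halt}$, set $\ell:=\ell+1$ and go to Step 1.1. Step 3: let $\ell_k$ be the current $\ell$ and set $x_{k+1}=\hat x_{k,\ell_k}$. Step 4: if $\alpha_{k,\ell_k}=\text{success}$, set $\tau_{k+1}=\max\{\tau_0,2^{\ell_k-1}\tau_k\}$, $k:=k+1$, and go to Step 1; otherwise stop. Evaluations are counted as calls of the first-order oracle $x\mapsto\{f(x),\nabla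 f(x)\}$: evaluating $f$ and/or $\nabla f$ at one point counts as one.
   Formalization: As printed, the bound R on T(ε) can fail if the last iteration ends with "solution" (e.g. f=Kx²/2, x₀=2/K, K large). Proved: T(ε) is finite; both bounds as printed if that iteration ends with "success" or T(ε)=0; in general both with R replaced by ⌈R⌉. *)

theory Defs
  imports "HOL-Analysis.Analysis" "HOL-Library.Multiset"
begin

section \<open>Smooth part\<close>

definition grad :: "(real^'n \<Rightarrow> real) \<Rightarrow> real^'n \<Rightarrow> real^'n" where
  "grad f x = (\<chi> i. frechet_derivative f (at x) (axis i 1))"

definition hessian :: "(real^'n \<Rightarrow> real) \<Rightarrow> real^'n \<Rightarrow> real^'n^'n" where
  "hessian f x = matrix (frechet_derivative (grad f) (at x))"

definition twice_continuously_differentiable :: "(real^'n \<Rightarrow> real) \<Rightarrow> bool" where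
  "twice_continuously_differentiable f \<longleftrightarrow>
     (\<forall>x. f differentiable (at x)) \<and> (\<forall>x. grad f differentiable (at x)) \<and>
     continuous_on UNIV (hessian f)"

definition spectral_norm :: "real^'n^'n \<Rightarrow> real" where
  "spectral_norm A = onorm (\<lambda>v. A *v v)"

section \<open>Extended-valued convex part\<close>

definition effective_domain :: "(real^'n \<Rightarrow> ereal) \<Rightarrow> (real^'n) set" where
  "effective_domain \<psi> = {x. \<psi> x < \<infinity>}"

definition extended_epigraph :: "(real^'n \<Rightarrow> ereal) \<Rightarrow> ((real^'n) \<times> real) set" where
  "extended_epigraph \<psi> = {(x, r). \<psi> x \<le> ereal r}"

definition proper_closed_convex :: "(real^'n \<Rightarrow> ereal) \<Rightarrow> bool" where
  "proper_closed_convex \<psi> \<longleftrightarrow>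
     (\<forall>x. \<psi> x \<noteq> -\<infinity>) \<and> effective_domain \<psi> \<noteq> {} \<and>
     closed (extended_epigraph \<psi>) \<and> convex (extended_epigraph \<psi>)"

definition subdifferential :: "(real^'n \<Rightarrow> ereal) \<Rightarrow> real^'n \<Rightarrow> (real^'n) set" where
  "subdifferential \<psi> x =
     {s. x \<in> effective_domain \<psi> \<and> (\<forall>y. \<psi> x + ereal (s \<bullet> (y - x)) \<le> \<psi> y)}"

definition objective :: "(real^'n \<Rightarrow> real) \<Rightarrow> (real^'n \<Rightarrow> ereal) \<Rightarrow> real^'n \<Rightarrow> ereal" where
  "objective f \<psi> x = ereal (f x) + \<psi> x"

definition optimal_value :: "(real^'n \<Rightarrow> real) \<Rightarrow> (real^'n \<Rightarrow> ereal) \<Rightarrow> ereal" where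
  "optimal_value f \<psi> = (INF x\<in>effective_domain \<psi>. objective f \<psi> x)"

section \<open>The procedure CubicSteps\<close>

definition cubic_model ::
  "(real^'n \<Rightarrow> real) \<Rightarrow> real^'n^'n \<Rightarrow> real \<Rightarrow> real^'n \<Rightarrow> real^'n \<Rightarrow> real" where
  "cubic_model f B \<sigma> x y =
     f x + grad f x \<bullet> (y - x) + 1/2 * ((B *v (y - x)) \<bullet> (y - x)) + \<sigma>/6 * norm (y - x) ^ 3"

text \<open>The pair \<open>(y, s)\<close> is an admissible result of the inexact minimization of the cubic model
  at \<open>x\<close>: the point \<open>y\<close> together with the subgradient \<open>s\<close> that certifies it.\<close>

definition cubic_step ::
  "(real^'n \<Rightarrow> real) \<Rightarrow> (real^'n \<Rightarrow> ereal) \<Rightarrow> real^'n^'n \<Rightarrow> real \<Rightarrow> real^'n \<Rightarrow> real^'n \<Rightarrow> real^'n \<Rightarrow> bool" where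
  "cubic_step f \<psi> B \<sigma> x y s \<longleftrightarrow>
     y \<in> effective_domain \<psi> \<and> s \<in> subdifferential \<psi> y \<and>
     ereal (cubic_model f B \<sigma> x y) + \<psi> y \<le> objective f \<psi> x \<and>
     norm (grad (cubic_model f B \<sigma> x) y + s) \<le> \<sigma>/4 * norm (y - x) ^ 2"

datatype outcome = Success | Solution | Halt

text \<open>\<open>cubic_loop f \<psi> B \<sigma> m \<epsilon> x\<^sub>0 t x P z a\<close>: the loop, entered with counter \<open>t\<close> and current
  point \<open>x\<close>, can compute successively the new points listed in \<open>P\<close> and return \<open>(z, a)\<close>. This is
  a relation since the inexact minimization is not deterministic.\<close>

inductive cubic_loop ::
  "(real^'n \<Rightarrow> real) \<Rightarrow> (real^'n \<Rightarrow> ereal) \<Rightarrow> real^'n^'n \<Rightarrow> real \<Rightarrow> nat \<Rightarrow> real \<Rightarrow> real^'n \<Rightarrow>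
   nat \<Rightarrow> real^'n \<Rightarrow> (real^'n) list \<Rightarrow> real^'n \<Rightarrow> outcome \<Rightarrow> bool"
  for f \<psi> B \<sigma> m \<epsilon> x\<^sub>0 where
  success: "cubic_loop f \<psi> B \<sigma> m \<epsilon> x\<^sub>0 m x [] x Success"
| solution: "t \<noteq> m \<Longrightarrow> cubic_step f \<psi> B \<sigma> x y s \<Longrightarrow> norm (grad f y + s) \<le> \<epsilon> \<Longrightarrow>
    cubic_loop f \<psi> B \<sigma> m \<epsilon> x\<^sub>0 t x [y] y Solution"
| continue: "t \<noteq> m \<Longrightarrow> cubic_step f \<psi> B \<sigma> x y s \<Longrightarrow> \<not> norm (grad f y + s) \<le> \<epsilon> \<Longrightarrow>
    objective f \<psi> x\<^sub>0 - objective f \<psi> y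
      \<ge> ereal (\<epsilon> powr (3/2) / (384 * \<sigma> powr (1/2)) * real (t + 1)) \<Longrightarrow>
    cubic_loop f \<psi> B \<sigma> m \<epsilon> x\<^sub>0 (t + 1) y P z a \<Longrightarrow>
    cubic_loop f \<psi> B \<sigma> m \<epsilon> x\<^sub>0 t x (y # P) z a"
| halt: "t \<noteq> m \<Longrightarrow> cubic_step f \<psi> B \<sigma> x y s \<Longrightarrow> \<not> norm (grad f y + s) \<le> \<epsilon> \<Longrightarrow>
    \<not> objective f \<psi> x\<^sub>0 - objective f \<psi> y
      \<ge> ereal (\<epsilon> powr (3/2) / (384 * \<sigma> powr (1/2)) * real (t + 1)) \<Longrightarrow>
    cubic_loop f \<psi> B \<sigma> m \<epsilon> x\<^sub>0 t x [y] y Halt"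

definition cubic_steps ::
  "(real^'n \<Rightarrow> real) \<Rightarrow> (real^'n \<Rightarrow> ereal) \<Rightarrow> real^'n \<Rightarrow> real^'n^'n \<Rightarrow> real \<Rightarrow> nat \<Rightarrow> real \<Rightarrow>
   (real^'n) list \<Rightarrow> real^'n \<Rightarrow> outcome \<Rightarrow> bool" where
  "cubic_steps f \<psi> x B \<sigma> m \<epsilon> P z a \<longleftrightarrow> cubic_loop f \<psi> B \<sigma> m \<epsilon> x 0 x P z a"

section \<open>The algorithm First-Order CNM\<close>

text \<open>In the next two definitions \<open>\<theta>\<close> stands for the trial value \<open>2^\<ell> * \<tau>\<^sub>k\<close>.\<close>

definition reg_param :: "real \<Rightarrow> nat \<Rightarrow> real" where
  "reg_param \<theta> m = 2^4 * (2/3) powr (1/3) * \<theta> * real m"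

definition fd_step :: "nat \<Rightarrow> real \<Rightarrow> nat \<Rightarrow> real \<Rightarrow> real" where
  "fd_step n \<theta> m \<epsilon> =
     (3 * reg_param \<theta> m powr (3/2) * \<epsilon> powr (3/2) / (2^7 * 192 * real n powr (3/2) * \<theta>^3)) powr (1/3)"

definition fd_matrix :: "(real^'n \<Rightarrow> real) \<Rightarrow> real^'n \<Rightarrow> real \<Rightarrow> real^'n^'n" where
  "fd_matrix f x h = (\<chi> i j. ((grad f (x + h *\<^sub>R axis j 1) - grad f x) /\<^sub>R h) $ i)"

definition fd_hessian :: "(real^'n \<Rightarrow> real) \<Rightarrow> real^'n \<Rightarrow> real \<Rightarrow> real^'n^'n" where
  "fd_hessian f x h = (1/2) *\<^sub>R (fd_matrix f x h + transpose (fd_matrix f x h))"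

text \<open>A run is described by the iterates \<open>x k\<close>, the parameters \<open>\<tau> k\<close>, and for every inner
  iteration \<open>(k, \<ell>)\<close> the result \<open>(xh k \<ell>, \<alpha> k \<ell>)\<close> of CubicSteps and the list \<open>P k \<ell>\<close> of
  points it computed. Entries belonging to iterations that are not executed are unconstrained;
  an outer iteration whose inner loop never ends, and an infinite sequence of outer iterations,
  are both possible a priori.\<close>

definition inner_reached :: "(nat \<Rightarrow> nat \<Rightarrow> outcome) \<Rightarrow> nat \<Rightarrow> nat \<Rightarrow> bool" where
  "inner_reached \<alpha> k l \<longleftrightarrow> (\<forall>j<l. \<alpha> k j = Halt)"

definition ends_at :: "(nat \<Rightarrow> nat \<Rightarrow> outcome) \<Rightarrow> nat \<Rightarrow> nat \<Rightarrow> bool" where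
  "ends_at \<alpha> k l \<longleftrightarrow> inner_reached \<alpha> k l \<and> \<alpha> k l \<noteq> Halt"

definition iteration_started :: "(nat \<Rightarrow> nat \<Rightarrow> outcome) \<Rightarrow> nat \<Rightarrow> bool" where
  "iteration_started \<alpha> k \<longleftrightarrow> (\<forall>j<k. \<exists>l. ends_at \<alpha> j l \<and> \<alpha> j l = Success)"

text \<open>The point \<open>x k\<close> is generated also if iteration \<open>k - 1\<close> ends the run with \<open>Solution\<close>, in
  which case iteration \<open>k\<close> is not started.\<close>

definition iterate_generated :: "(nat \<Rightarrow> nat \<Rightarrow> outcome) \<Rightarrow> nat \<Rightarrow> bool" where
  "iterate_generated \<alpha> k \<longleftrightarrow>
     k = 0 \<or> (iteration_started \<alpha> (k - 1) \<and> (\<exists>l. ends_at \<alpha> (k - 1) l))"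

definition first_order_CNM_run ::
  "(real^'n \<Rightarrow> real) \<Rightarrow> (real^'n \<Rightarrow> ereal) \<Rightarrow> real^'n \<Rightarrow> real \<Rightarrow> real \<Rightarrow> nat \<Rightarrow>
   (nat \<Rightarrow> real^'n) \<Rightarrow> (nat \<Rightarrow> real) \<Rightarrow> (nat \<Rightarrow> nat \<Rightarrow> real^'n) \<Rightarrow> (nat \<Rightarrow> nat \<Rightarrow> outcome) \<Rightarrow>
   (nat \<Rightarrow> nat \<Rightarrow> (real^'n) list) \<Rightarrow> bool" where
  "first_order_CNM_run f \<psi> x\<^sub>0 \<tau>\<^sub>0 \<epsilon> m x \<tau> xh \<alpha> P \<longleftrightarrow>
     x 0 = x\<^sub>0 \<and> \<tau> 0 = \<tau>\<^sub>0 \<and>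
     (\<forall>k. iteration_started \<alpha> k \<longrightarrow>
        (\<forall>l. inner_reached \<alpha> k l \<longrightarrow>
           cubic_steps f \<psi> (x k)
             (fd_hessian f (x k) (fd_step CARD('n) (2^l * \<tau> k) m \<epsilon>))
             (reg_param (2^l * \<tau> k) m) m \<epsilon> (P k l) (xh k l) (\<alpha> k l)) \<and>
        (\<forall>l. ends_at \<alpha> k l \<longrightarrow>
           x (k + 1) = xh k l \<and>
           (\<alpha> k l = Success \<longrightarrow> \<tau> (k + 1) = max \<tau>\<^sub>0 (2 powi (int l - 1) * \<tau> k))))"

section \<open>Stopping index and oracle complexity\<close>

definition eps_stationary ::
  "(real^'n \<Rightarrow> real) \<Rightarrow> (real^'n \<Rightarrow> ereal) \<Rightarrow> real \<Rightarrow> real^'n \<Rightarrow> bool" where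
  "eps_stationary f \<psi> \<epsilon> x \<longleftrightarrow> (\<exists>s\<in>subdifferential \<psi> x. norm (grad f x + s) \<le> \<epsilon>)"

text \<open>The infimum of the empty set is \<open>\<infinity>\<close>.\<close>

definition stopping_index ::
  "(real^'n \<Rightarrow> real) \<Rightarrow> (real^'n \<Rightarrow> ereal) \<Rightarrow> real \<Rightarrow>
   (nat \<Rightarrow> real^'n) \<Rightarrow> (nat \<Rightarrow> nat \<Rightarrow> outcome) \<Rightarrow> enat" where
  "stopping_index f \<psi> \<epsilon> x \<alpha> =
     (INF k\<in>{k. iterate_generated \<alpha> k \<and> eps_stationary f \<psi> \<epsilon> (x k)}. enat k)"

text \<open>Points passed to the oracle \<open>x \<mapsto> (f x, \<nabla>f x)\<close> in the inner iteration \<open>(k, \<ell>)\<close>: the base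
  point and the \<open>n\<close> shifted points for the finite differences; then, in CubicSteps, its starting
  point and all points it computes. Values are reused inside each of the two parts, but not
  between them nor between different inner iterations, so any further caching can only lower
  the count.\<close>

definition oracle_queries :: "real^'n \<Rightarrow> real \<Rightarrow> (real^'n) list \<Rightarrow> (real^'n) multiset" where
  "oracle_queries x h P =
     add_mset x (image_mset (\<lambda>i. x + h *\<^sub>R axis i 1) (mset_set UNIV)) + mset (x # P)"

text \<open>Meaningful for the first \<open>T\<close> iterations if their inner loops end; the least \<open>\<ell>\<close> below is
  then the index \<open>\<ell>\<^sub>k\<close> of the last inner iteration.\<close>

definition oracle_calls ::
  "real \<Rightarrow> nat \<Rightarrow> (nat \<Rightarrow> real^'n) \<Rightarrow> (nat \<Rightarrow> real) \<Rightarrow> (nat \<Rightarrow> nat \<Rightarrow> outcome) \<Rightarrow>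
   (nat \<Rightarrow> nat \<Rightarrow> (real^'n) list) \<Rightarrow> nat \<Rightarrow> nat" where
  "oracle_calls \<epsilon> m x \<tau> \<alpha> P T =
     (\<Sum>k<T. \<Sum>l\<le>(LEAST l. \<alpha> k l \<noteq> Halt).
        size (oracle_queries (x k) (fd_step CARD('n) (2^l * \<tau> k) m \<epsilon>) (P k l)))"

text \<open>Why the main theorem has two forms of each bound. Let \<open>R\<close> be the bound
  on the stopping index \<open>T\<close>. If iteration \<open>T - 1\<close> ends with \<open>Success\<close> (so that iteration \<open>T\<close> is
  started), each of the first \<open>T\<close> iterations decreases the objective by a fixed amount, and
  \<open>T \<le> R\<close>. If iteration \<open>T - 1\<close> ends with \<open>Solution\<close>, its decrease is not controlled and \<open>T \<le> R\<close>
  can fail: for \<open>n = m = 1\<close>, \<open>f x = K/2 * x\<^sup>2\<close>, \<open>\<psi> = 0\<close>, \<open>L = 0\<close>, \<open>\<tau>\<^sub>0 = \<epsilon> = 1\<close> and \<open>x\<^sub>0 = 2/K\<close> one has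
  \<open>T \<ge> 1\<close>, while \<open>R\<close> and the corresponding bound on the oracle calls tend to \<open>0\<close> as \<open>K\<close> grows.
  There \<open>R\<close> has to be rounded up to an integer.\<close>

end

theory Submission
  imports Defs
begin

text \<open>Write \<open>\<theta> = 2^\<ell> \<tau>\<^sub>k\<close>. If \<open>\<theta> \<ge> L\<close>, CubicSteps never halts. With \<open>r\<close> the length of the current step and
  \<open>u\<close> the distance of its starting point from the base point, at which \<open>B\<close> approximates the Hessian
  with error \<open>\<delta>\<close>, Taylor's formula bounds the decrease of the objective below by
  \<open>(\<sigma> - L)/6 r^3 - (\<delta> + L u)/2 r^2\<close>, and the failure of the stopping test gives
  \<open>\<epsilon> \<le> (3/4 \<sigma> + L/2) r^2 + (\<delta> + L u) r\<close>. Together they yield a decrease of order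
  \<open>\<epsilon>^(3/2) / \<sigma>^(1/2) + \<sigma> r^3\<close> up to \<open>(\<delta> + L u)^3 / \<sigma>^2\<close>. The choice of \<open>h\<close> absorbs \<open>\<delta>^3\<close> into the
  first term, and the choice of \<open>\<sigma>\<close>, proportional to \<open>m\<close>, lets the cubes of the earlier step lengths
  absorb \<open>u^3\<close>.

  Hence \<open>2^(\<ell>\<^sub>k) \<tau>\<^sub>k \<le> 2 max {\<tau>\<^sub>0, L}\<close>, every successful outer iteration decreases the objective by a fixed
  amount, and the number of inner iterations telescopes through \<open>log\<^sub>2 (\<tau>\<^sub>k\<^sub>+\<^sub>1 / \<tau>\<^sub>k)\<close>. If the run ends in
  iteration \<open>T - 1\<close> with a solution, \<open>x\<^bsub>T - 1\<^esub>\<close> is not stationary, hence not a minimizer, so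
  \<open>T - 1 < R\<close> strictly and \<open>T \<le> \<lceil>R\<rceil>\<close>.\<close>

section \<open>Functions with Lipschitz continuous Hessian\<close>

lemma has_derivative_grad:
  fixes f :: "real^'n \<Rightarrow> real"
  assumes "f differentiable (at x)"
  shows "(f has_derivative (\<lambda>v. grad f x \<bullet> v)) (at x)"
proof -
  let ?D = "frechet_derivative f (at x)"
  have D: "(f has_derivative ?D) (at x)"
    using assms frechet_derivative_works by blast
  then have lin: "linear ?D"
    by (simp add: has_derivative_linear)
  have "?D v = grad f x \<bullet> v" for v
  proof -
    have "?D v = ?D (\<Sum>i\<in>UNIV. (v $ i) *\<^sub>R axis i 1)"
      by (metis (no_types) basis_expansion scalar_mult_eq_scaleR)
    also have "\<dots> = (\<Sum>i\<in>UNIV. (v $ i) * ?D (axis i 1))"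
      by (simp add: linear_sum[OF lin] linear_cmul[OF lin])
    also have "\<dots> = grad f x \<bullet> v"
      by (simp add: grad_def inner_vec_def mult.commute)
    finally show ?thesis .
  qed
  then have "?D = (\<lambda>v. grad f x \<bullet> v)" by auto
  with D show ?thesis by simp
qed

lemma grad_eqI:
  fixes f :: "real^'n \<Rightarrow> real"
  assumes "(f has_derivative (\<lambda>v. g \<bullet> v)) (at x)"
  shows "grad f x = g"
proof -
  have "frechet_derivative f (at x) = (\<lambda>v. g \<bullet> v)"
    using frechet_derivative_at[OF assms] by simp
  then show ?thesis
    by (simp add: grad_def vec_eq_iff inner_axis)
qed

lemma has_derivative_hessian:
  fixes f :: "real^'n \<Rightarrow> real"
  assumes "grad f differentiable (at x)"
  shows "(grad f has_derivative (\<lambda>v. hessian f x *v v)) (at x)"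
proof -
  have D: "(grad f has_derivative frechet_derivative (grad f) (at x)) (at x)"
    using assms frechet_derivative_works by blast
  then have "frechet_derivative (grad f) (at x) = (\<lambda>v. hessian f x *v v)"
    unfolding hessian_def by (simp add: has_derivative_linear matrix_works)
  with D show ?thesis by simp
qed

lemma spectral_norm_bound:
  fixes A :: "real^'n^'n"
  shows "norm (A *v v) \<le> spectral_norm A * norm v"
  unfolding spectral_norm_def by (rule onorm) simp

locale lipschitz_hessian =
  fixes f :: "real^'n \<Rightarrow> real" and L :: real
  assumes f_differentiable: "f differentiable (at x)"
    and grad_differentiable: "grad f differentiable (at x)"
    and L_nonneg: "0 \<le> L"
    and hessian_lipschitz: "spectral_norm (hessian f v - hessian f u) \<le> L * norm (v - u)"
begin

lemma hessian_difference_bound: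
  "norm (hessian f v *v d - hessian f u *v d) \<le> L * norm (v - u) * norm d"
proof -
  have "norm ((hessian f v - hessian f u) *v d) \<le> spectral_norm (hessian f v - hessian f u) * norm d"
    by (rule spectral_norm_bound)
  also have "\<dots> \<le> L * norm (v - u) * norm d"
    by (intro mult_right_mono hessian_lipschitz) simp
  finally show ?thesis by (simp add: matrix_vector_mult_diff_rdistrib)
qed

lemma inner_grad_has_real_derivative:
  "((\<lambda>t. v \<bullet> grad f (x + t *\<^sub>R d)) has_real_derivative v \<bullet> (hessian f (x + t *\<^sub>R d) *v d)) (at t)"
proof -
  have "((\<lambda>t. x + t *\<^sub>R d) has_derivative (\<lambda>s. s *\<^sub>R d)) (at t)"
    by (auto intro!: derivative_eq_intros)
  from has_derivative_compose[OF this has_derivative_hessian[OF grad_differentiable]]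
  have "((\<lambda>t. grad f (x + t *\<^sub>R d)) has_derivative (\<lambda>s. hessian f (x + t *\<^sub>R d) *v (s *\<^sub>R d))) (at t)" .
  from has_derivative_inner_right[OF this, of v] show ?thesis
    by (rule has_derivative_imp_has_field_derivative) (simp add: matrix_vector_mult_scaleR)
qed

lemma f_has_real_derivative:
  "((\<lambda>t. f (x + t *\<^sub>R d)) has_real_derivative grad f (x + t *\<^sub>R d) \<bullet> d) (at t)"
proof -
  have "((\<lambda>t. x + t *\<^sub>R d) has_derivative (\<lambda>s. s *\<^sub>R d)) (at t)"
    by (auto intro!: derivative_eq_intros)
  from has_derivative_compose[OF this has_derivative_grad[OF f_differentiable]]
  show ?thesis
    by (rule has_derivative_imp_has_field_derivative) simp
qed

text \<open>The remainder \<open>w\<close> is tested against itself, which reduces the claim to a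
  scalar function along the segment. The Lipschitz bound on the Hessian makes \<open>\<phi>\<close>
  nonincreasing, and \<open>\<phi> 1 \<le> \<phi> 0\<close> bounds
  \<open>w \<bullet> w\<close>.\<close>

lemma grad_taylor:
  "norm (grad f (x + d) - grad f x - hessian f x *v d) \<le> L / 2 * norm d ^ 2"
proof -
  define w where "w = grad f (x + d) - grad f x - hessian f x *v d"
  define \<phi> where "\<phi> t = w \<bullet> grad f (x + t *\<^sub>R d) - t * (w \<bullet> (hessian f x *v d))
     - t ^ 2 * (L / 2 * norm d ^ 2 * norm w)" for t
  have "\<phi> 0 \<ge> \<phi> 1"
  proof (rule DERIV_nonpos_imp_nonincreasing[where f = \<phi>])
    fix t :: real assume t: "0 \<le> t" "t \<le> 1"
    have "(\<phi> has_real_derivative w \<bullet> (hessian f (x + t *\<^sub>R d) *v d) - w \<bullet> (hessian f x *v d)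
        - t * (L * norm d ^ 2 * norm w)) (at t)"
      unfolding \<phi>_def
      by (auto intro!: derivative_eq_intros inner_grad_has_real_derivative simp: field_simps)
    note D = this
    have le: "w \<bullet> (hessian f (x + t *\<^sub>R d) *v d) - w \<bullet> (hessian f x *v d)
        \<le> t * (L * norm d ^ 2 * norm w)"
    proof -
      have "w \<bullet> (hessian f (x + t *\<^sub>R d) *v d - hessian f x *v d)
          \<le> norm w * norm (hessian f (x + t *\<^sub>R d) *v d - hessian f x *v d)"
        by (rule norm_cauchy_schwarz)
      also have "\<dots> \<le> norm w * (L * norm (x + t *\<^sub>R d - x) * norm d)"
        by (intro mult_left_mono hessian_difference_bound) simp
      also have "\<dots> = t * (L * norm d ^ 2 * norm w)"
        using t by (simp add: power2_eq_square)
      finally show ?thesis by (simp add: inner_diff_right)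
    qed
    show "\<exists>y. (\<phi> has_real_derivative y) (at t) \<and> y \<le> 0"
      by (rule exI, rule conjI, rule D) (use le in linarith)
  qed simp
  then have "w \<bullet> w \<le> L / 2 * norm d ^ 2 * norm w"
    by (simp add: \<phi>_def w_def inner_diff_right)
  then have "norm w * norm w \<le> (L / 2 * norm d ^ 2) * norm w"
    by (simp add: dot_square_norm power2_eq_square)
  then have "norm w \<le> L / 2 * norm d ^ 2"
    using L_nonneg by (cases "norm w = 0") (auto dest: mult_right_le_imp_le)
  then show ?thesis by (simp add: w_def)
qed

text \<open>Same monotonicity argument one order higher: \<open>grad_taylor\<close> at
  \<open>t *\<^sub>R d\<close> controls the derivative of \<open>\<phi>\<close>.\<close>

lemma f_taylor:
  "f (x + d) \<le> f x + grad f x \<bullet> d + 1/2 * ((hessian f x *v d) \<bullet> d) + L / 6 * norm d ^ 3"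
proof -
  define \<phi> where "\<phi> t = f (x + t *\<^sub>R d) - t * (grad f x \<bullet> d) - t^2 * (1/2 * ((hessian f x *v d) \<bullet> d))
     - t^3 * (L / 6 * norm d ^ 3)" for t
  have "\<phi> 0 \<ge> \<phi> 1"
  proof (rule DERIV_nonpos_imp_nonincreasing[where f = \<phi>])
    fix t :: real assume t: "0 \<le> t" "t \<le> 1"
    have "(\<phi> has_real_derivative grad f (x + t *\<^sub>R d) \<bullet> d - grad f x \<bullet> d - t * ((hessian f x *v d) \<bullet> d)
        - t^2 * (L / 2 * norm d ^ 3)) (at t)"
      unfolding \<phi>_def
      by (auto intro!: derivative_eq_intros f_has_real_derivative simp: field_simps)
    note D = this
    have le: "grad f (x + t *\<^sub>R d) \<bullet> d - grad f x \<bullet> d - t * ((hessian f x *v d) \<bullet> d)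
        \<le> t^2 * (L / 2 * norm d ^ 3)"
    proof -
      have "(grad f (x + t *\<^sub>R d) - grad f x - hessian f x *v (t *\<^sub>R d)) \<bullet> d
          \<le> norm (grad f (x + t *\<^sub>R d) - grad f x - hessian f x *v (t *\<^sub>R d)) * norm d"
        by (rule norm_cauchy_schwarz)
      also have "\<dots> \<le> L / 2 * norm (t *\<^sub>R d) ^ 2 * norm d"
        by (intro mult_right_mono grad_taylor) simp
      also have "\<dots> = t^2 * (L / 2 * norm d ^ 3)"
        using t by (simp add: power2_eq_square power3_eq_cube)
      finally show ?thesis
        by (simp add: inner_diff_left matrix_vector_mult_scaleR)
    qed
    show "\<exists>y. (\<phi> has_real_derivative y) (at t) \<and> y \<le> 0"
      by (rule exI, rule conjI, rule D) (use le in linarith)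
  qed simp
  then show ?thesis by (simp add: \<phi>_def)
qed

text \<open>The second difference is symmetric in \<open>a\<close> and \<open>b\<close>, which makes the Hessian symmetric.\<close>

lemma second_difference_bound:
  assumes "0 < s" "s \<le> 1"
  shows "\<bar>f (x + s *\<^sub>R a + s *\<^sub>R b) - f (x + s *\<^sub>R a) - f (x + s *\<^sub>R b) + f x
      - s^2 * (a \<bullet> (hessian f x *v b))\<bar> \<le> s^3 * (norm a * L * (norm a + norm b)^2)"
proof -
  define K where "K = norm a * L * (norm a + norm b)^2"
  \<comment> \<open>Both gradients are expanded at \<open>x\<close>. The linear terms in
    \<open>t\<close> cancel, and the two remainders are of order \<open>s^2\<close>.\<close>
  have K: "\<bar>(grad f (x + s *\<^sub>R b + t *\<^sub>R a) - grad f (x + t *\<^sub>R a)) \<bullet> a - s * (a \<bullet> (hessian f x *v b))\<bar>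
      \<le> s^2 * K" if t: "0 \<le> t" "t \<le> s" for t
  proof -
    let ?R = "\<lambda>d. grad f (x + d) - grad f x - hessian f x *v d"
    have "t * norm a \<le> s * norm a" "0 \<le> s * norm b" using t assms by (simp_all add: mult_right_mono)
    moreover have "norm (t *\<^sub>R a) = t * norm a" "norm (s *\<^sub>R b) = s * norm b" using t assms by simp_all
    ultimately have 1: "norm (t *\<^sub>R a) \<le> s * (norm a + norm b)"
      and 2: "norm (s *\<^sub>R b + t *\<^sub>R a) \<le> s * (norm a + norm b)"
      using norm_triangle_ineq[of "s *\<^sub>R b" "t *\<^sub>R a"] unfolding distrib_left by linarith+
    have R: "norm (?R d) \<le> L / 2 * (s * (norm a + norm b))^2" if "norm d \<le> s * (norm a + norm b)" for d
    proof -
      have "L / 2 * norm d ^ 2 \<le> L / 2 * (s * (norm a + norm b))^2"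
        using that L_nonneg by (intro mult_left_mono power_mono) auto
      with grad_taylor[of x d] show ?thesis by linarith
    qed
    have "(grad f (x + s *\<^sub>R b + t *\<^sub>R a) - grad f (x + t *\<^sub>R a)) \<bullet> a - s * (a \<bullet> (hessian f x *v b))
        = (?R (s *\<^sub>R b + t *\<^sub>R a) - ?R (t *\<^sub>R a)) \<bullet> a"
      by (simp add: matrix_vector_mult_scaleR matrix_vector_right_distrib inner_diff_left
          inner_add_left add.assoc inner_commute[of a])
    then have "\<bar>(grad f (x + s *\<^sub>R b + t *\<^sub>R a) - grad f (x + t *\<^sub>R a)) \<bullet> a - s * (a \<bullet> (hessian f x *v b))\<bar>
        \<le> norm (?R (s *\<^sub>R b + t *\<^sub>R a) - ?R (t *\<^sub>R a)) * norm a"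
      by (simp only: Cauchy_Schwarz_ineq2)
    also have "\<dots> \<le> (L / 2 * (s * (norm a + norm b))^2 + L / 2 * (s * (norm a + norm b))^2) * norm a"
      by (intro mult_right_mono order_trans[OF norm_triangle_ineq4] add_mono R 1 2) simp
    also have "\<dots> = s^2 * K" by (simp add: K_def power_mult_distrib)
    finally show ?thesis .
  qed
  \<comment> \<open>Integration over \<open>t\<close> from 0 to \<open>s\<close> in direction
    \<open>a\<close> gains the third power of \<open>s\<close>. The sign \<open>\<sigma>\<close>
    treats both halves of the absolute value at once.\<close>
  have mono: "\<sigma> * (f (x + s *\<^sub>R b + s *\<^sub>R a) - f (x + s *\<^sub>R a) - f (x + s *\<^sub>R b) + f x
      - s^2 * (a \<bullet> (hessian f x *v b))) \<le> s^3 * K" if \<sigma>: "\<bar>\<sigma>\<bar> = 1" for \<sigma> :: real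
  proof -
    define \<phi> where "\<phi> t = \<sigma> * (f (x + s *\<^sub>R b + t *\<^sub>R a) - f (x + t *\<^sub>R a)
      - t * (s * (a \<bullet> (hessian f x *v b)))) - t * (s^2 * K)" for t
    have "\<phi> 0 \<ge> \<phi> s"
    proof (rule DERIV_nonpos_imp_nonincreasing[where f = \<phi>])
      fix t :: real assume t: "0 \<le> t" "t \<le> s"
      have "(\<phi> has_real_derivative \<sigma> * ((grad f (x + s *\<^sub>R b + t *\<^sub>R a) - grad f (x + t *\<^sub>R a)) \<bullet> a
          - s * (a \<bullet> (hessian f x *v b))) - s^2 * K) (at t)"
        unfolding \<phi>_def
        by (auto intro!: derivative_eq_intros f_has_real_derivative simp: inner_diff_left)
      note D = this
      have le: "\<sigma> * ((grad f (x + s *\<^sub>R b + t *\<^sub>R a) - grad f (x + t *\<^sub>R a)) \<bullet> a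
          - s * (a \<bullet> (hessian f x *v b))) \<le> s^2 * K"
      proof -
        have "\<sigma> = 1 \<or> \<sigma> = -1" using \<sigma> by linarith
        then show ?thesis using abs_le_D1[OF K[OF t]] abs_le_D2[OF K[OF t]] by auto
      qed
      show "\<exists>y. (\<phi> has_real_derivative y) (at t) \<and> y \<le> 0"
        by (rule exI, rule conjI, rule D) (use le in linarith)
    qed (use assms in simp)
    then show ?thesis by (simp add: \<phi>_def algebra_simps power2_eq_square power3_eq_cube)
  qed
  show ?thesis using mono[of 1] mono[of "-1"] by (simp add: K_def add_ac abs_le_iff)
qed

text \<open>Both orders of differencing approximate the same second difference up to
  \<open>O(s^3)\<close>. Division by \<open>s^2\<close> leaves a discrepancy of order
  \<open>s\<close>, and \<open>s\<close> tends to 0.\<close>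

lemma hessian_symmetric: "a \<bullet> (hessian f x *v b) = b \<bullet> (hessian f x *v a)"
proof -
  define K where "K = norm a * L * (norm a + norm b)^2 + norm b * L * (norm b + norm a)^2"
  define c where "c = \<bar>a \<bullet> (hessian f x *v b) - b \<bullet> (hessian f x *v a)\<bar>"
  have c: "c \<le> s * K" if s: "0 < s" "s \<le> 1" for s
  proof -
    have "f (x + s *\<^sub>R b + s *\<^sub>R a) = f (x + s *\<^sub>R a + s *\<^sub>R b)" by (simp add: add_ac)
    then have "\<bar>s^2 * (a \<bullet> (hessian f x *v b)) - s^2 * (b \<bullet> (hessian f x *v a))\<bar> \<le> s^3 * K"
      using second_difference_bound[OF s, of x a b] second_difference_bound[OF s, of x b a]
      unfolding K_def distrib_left[of "s^3"] by linarith
    moreover have "\<bar>s^2 * (a \<bullet> (hessian f x *v b)) - s^2 * (b \<bullet> (hessian f x *v a))\<bar> = s^2 * c"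
      by (simp add: c_def abs_mult flip: right_diff_distrib)
    ultimately have "s^2 * c \<le> s^2 * (s * K)" by (simp add: power2_eq_square power3_eq_cube)
    then show ?thesis using s by simp
  qed
  have "((\<lambda>s. s * K) \<longlongrightarrow> 0 * K) (at_right 0)"
    by (intro tendsto_intros)
  moreover have "eventually (\<lambda>s. c \<le> s * K) (at_right 0)"
    using c by (auto simp: eventually_at_right[OF zero_less_one] intro!: exI[of _ 1])
  ultimately have "c \<le> 0"
    by (metis mult_zero_left tendsto_lowerbound trivial_limit_at_right_real)
  then show ?thesis by (simp add: c_def)
qed

lemma transpose_hessian: "transpose (hessian f x) = hessian f x"
  by (metis dot_lmul_matrix hessian_symmetric inner_commute matrix_eq transpose_matrix_vector vector_eq_rdot)

section \<open>Error of the finite-difference Hessian\<close>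

text \<open>By \<open>grad_taylor\<close> each column is off by at most \<open>L * h / 2\<close>.
  Cauchy-Schwarz against the all-ones vector turns the sum of the \<open>\<bar>v $ j\<bar>\<close>
  into the factor \<open>sqrt n\<close>.\<close>

lemma fd_matrix_error:
  assumes "0 < h"
  shows "norm (fd_matrix f x h *v v - hessian f x *v v) \<le> L * h / 2 * (sqrt (real CARD('n)) * norm v)"
proof -
  let ?E = "\<lambda>j. (grad f (x + h *\<^sub>R axis j 1) - grad f x) /\<^sub>R h - hessian f x *v axis j 1"
  have col: "norm (?E j) \<le> L * h / 2" for j
  proof -
    have "?E j = (grad f (x + h *\<^sub>R axis j 1) - grad f x - hessian f x *v (h *\<^sub>R axis j 1)) /\<^sub>R h"
      using assms by (simp add: matrix_vector_mult_scaleR scaleR_diff_right)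
    then have "norm (?E j) = norm (grad f (x + h *\<^sub>R axis j 1) - grad f x - hessian f x *v (h *\<^sub>R axis j 1)) / h"
      using assms by (simp add: divide_inverse_commute)
    also have "\<dots> \<le> (L / 2 * norm (h *\<^sub>R axis j (1::real)) ^ 2) / h"
      using assms by (intro divide_right_mono grad_taylor) simp
    also have "\<dots> = L * h / 2" using assms by (simp add: power2_eq_square)
    finally show ?thesis .
  qed
  have "fd_matrix f x h *v v - hessian f x *v v = (\<Sum>j\<in>UNIV. v $ j *\<^sub>R ?E j)"
  proof -
    have "fd_matrix f x h *v v = (\<Sum>j\<in>UNIV. v $ j *\<^sub>R ((grad f (x + h *\<^sub>R axis j 1) - grad f x) /\<^sub>R h))"
      by (simp add: matrix_mult_sum column_def fd_matrix_def scalar_mult_eq_scaleR vec_eq_iff mult_ac)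
    moreover have "hessian f x *v v = (\<Sum>j\<in>UNIV. v $ j *\<^sub>R (hessian f x *v axis j 1))"
      by (simp add: matrix_mult_sum[of _ v] scalar_mult_eq_scaleR matrix_vector_mult_basis)
    ultimately show ?thesis by (simp add: scaleR_diff_right sum_subtractf)
  qed
  then have "norm (fd_matrix f x h *v v - hessian f x *v v) \<le> (\<Sum>j\<in>UNIV. norm (v $ j *\<^sub>R ?E j))"
    by (simp only: norm_sum)
  also have "\<dots> \<le> (\<Sum>j\<in>UNIV. \<bar>v $ j\<bar> * (L * h / 2))"
    unfolding norm_scaleR by (intro sum_mono mult_mono col) auto
  also have "\<dots> = L * h / 2 * (\<Sum>j\<in>UNIV. \<bar>1\<bar> * \<bar>v $ j\<bar>)"
    by (simp add: sum_distrib_left mult.commute)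
  also have "\<dots> \<le> L * h / 2 * (L2_set (\<lambda>_. 1) (UNIV::'n set) * L2_set (\<lambda>j. v $ j) UNIV)"
    using assms L_nonneg by (intro mult_left_mono L2_set_mult_ineq) simp
  also have "\<dots> = L * h / 2 * (sqrt (real CARD('n)) * norm v)"
    by (simp add: L2_set_def norm_vec_def)
  finally show ?thesis .
qed

end

text \<open>A matrix and its adjoint have the same operator norm: move \<open>A\<close> across the
  inner product of \<open>transpose A *v w\<close> with itself.\<close>

lemma transpose_norm_bound:
  fixes A :: "real^'n^'m"
  assumes "\<And>v. norm (A *v v) \<le> c * norm v"
  shows "norm (transpose A *v w) \<le> c * norm w"
proof -
  let ?u = "transpose A *v w"
  have "?u \<bullet> ?u = w \<bullet> (A *v ?u)"
    by (simp add: dot_lmul_matrix)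
  also have "\<dots> \<le> norm w * norm (A *v ?u)" by (rule norm_cauchy_schwarz)
  also have "\<dots> \<le> norm w * (c * norm ?u)" by (intro mult_left_mono assms) simp
  finally have le: "norm ?u * norm ?u \<le> (c * norm w) * norm ?u"
    by (simp add: dot_square_norm power2_eq_square mult_ac)
  show ?thesis
  proof (cases "norm ?u = 0")
    case True
    \<comment> \<open>The sign of \<open>c\<close> follows from the assumed bound at any nonzero
      vector; an arbitrary basis vector serves.\<close>
    have "0 \<le> c * norm (axis undefined 1 :: real^'n)" using assms norm_ge_zero order_trans by blast
    then have "0 \<le> c" by simp
    then show ?thesis using True by simp
  next
    case False
    then show ?thesis using le by (metis mult_right_le_imp_le norm_ge_zero order_le_less)
  qed
qed

lemma transpose_fd_hessian: "transpose (fd_hessian f x h) = fd_hessian f x h"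
  by (simp add: fd_hessian_def transpose_def vec_eq_iff)

text \<open>Symmetrizing costs nothing: as the Hessian is symmetric, the new error is the average of
  \<open>E\<close> and its transpose, which obey the same bound.\<close>

lemma (in lipschitz_hessian) fd_hessian_error:
  assumes "0 < h"
  shows "norm (fd_hessian f x h *v v - hessian f x *v v) \<le> L * h / 2 * sqrt (real CARD('n)) * norm v"
proof -
  define E where "E = fd_matrix f x h - hessian f x"
  have E: "norm (E *v v) \<le> L * h / 2 * sqrt (real CARD('n)) * norm v" for v
    using fd_matrix_error[OF assms, of x v]
    by (simp add: E_def matrix_vector_mult_diff_rdistrib mult.assoc)
  have "hessian f x $ i $ j = hessian f x $ j $ i" for i j
    using transpose_hessian[of x] by (metis transpose_def vec_lambda_beta)
  then have "fd_hessian f x h = hessian f x + (1/2) *\<^sub>R (E + transpose E)"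
    by (simp add: E_def fd_hessian_def transpose_def vec_eq_iff field_simps)
  then have "fd_hessian f x h *v v - hessian f x *v v = (1/2) *\<^sub>R (E *v v + transpose E *v v)"
    by (simp add: matrix_vector_mult_add_rdistrib scaleR_matrix_vector_assoc[symmetric]
        del: transpose_matrix_vector)
  then have "norm (fd_hessian f x h *v v - hessian f x *v v) \<le> 1/2 * (norm (E *v v) + norm (transpose E *v v))"
    using norm_triangle_ineq[of "E *v v" "transpose E *v v"] by simp
  also have "\<dots> \<le> L * h / 2 * sqrt (real CARD('n)) * norm v"
    using add_mono[OF E[of v] transpose_norm_bound[OF E, of v]] by (simp del: transpose_matrix_vector add: mult_ac)
  finally show ?thesis .
qed

section \<open>Gradient of the cubic model\<close>

text \<open>The norm is not differentiable at 0, so the chain rule covers only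
  \<open>y \<noteq> z\<close>. At \<open>y = z\<close> the difference quotient is the squared norm,
  which tends to 0.\<close>

lemma has_derivative_norm_cubed:
  fixes z :: "'a::real_inner"
  shows "((\<lambda>y. norm (y - z) ^ 3) has_derivative (\<lambda>v. 3 * norm (y - z) * ((y - z) \<bullet> v))) (at y)"
proof (cases "y = z")
  case True
  have "((\<lambda>y. norm (y - z) ^ 2) \<longlongrightarrow> norm (z - z) ^ 2) (at z)"
    by (intro tendsto_intros)
  then have "((\<lambda>y. norm (y - z) ^ 3 / norm (y - z)) \<longlongrightarrow> 0) (at z)"
    unfolding diff_self norm_zero zero_power2
    by (rule Lim_transform_eventually)
      (auto simp: eventually_at_filter power3_eq_cube power2_eq_square)
  then show ?thesis
    using True by (simp add: has_derivative_iff_norm bounded_linear_zero)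
next
  case False
  have N: "(norm has_derivative (\<lambda>v. sgn (y - z) \<bullet> v)) (at (y - z))"
    using has_derivative_norm[of "y - z"] False by (simp add: inner_commute)
  have "((\<lambda>y. y - z) has_derivative (\<lambda>v. v)) (at y)"
    by (auto intro!: derivative_eq_intros)
  from has_derivative_compose[OF this N]
  have "((\<lambda>y. norm (y - z)) has_derivative (\<lambda>v. sgn (y - z) \<bullet> v)) (at y)" .
  moreover have "sgn (y - z) \<bullet> v = ((y - z) \<bullet> v) / norm (y - z)" for v
    by (simp add: sgn_div_norm divide_inverse_commute)
  ultimately have "((\<lambda>y. norm (y - z)) has_derivative (\<lambda>v. ((y - z) \<bullet> v) / norm (y - z))) (at y)"
    by simp
  from has_derivative_power[OF this, of 3] show ?thesis
    by (rule has_derivative_eq_rhs) (use False in \<open>auto simp: power2_eq_square\<close>)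
qed

text \<open>Symmetry of \<open>B\<close> makes the quadratic form contribute
  \<open>B *v (y - x)\<close> rather than the average of \<open>B\<close> and its transpose.\<close>

lemma grad_cubic_model:
  fixes B :: "real^'n^'n"
  assumes "transpose B = B"
  shows "grad (cubic_model f B \<sigma> x) y
     = grad f x + B *v (y - x) + (\<sigma> / 2 * norm (y - x)) *\<^sub>R (y - x)"
proof (rule grad_eqI)
  have [derivative_intros]: "((\<lambda>y. B *v (y - x)) has_derivative (\<lambda>v. B *v v)) (at y)"
    by (rule has_derivative_eq_rhs, rule bounded_linear.has_derivative[OF matrix_vector_mul_bounded_linear])
      (auto intro!: derivative_eq_intros)
  have sym: "(B *v v) \<bullet> w = (B *v w) \<bullet> v" for v w
    by (metis assms dot_lmul_matrix inner_commute transpose_matrix_vector)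
  show "(cubic_model f B \<sigma> x has_derivative
     (\<lambda>v. (grad f x + B *v (y - x) + (\<sigma> / 2 * norm (y - x)) *\<^sub>R (y - x)) \<bullet> v)) (at y)"
    unfolding cubic_model_def
    by (rule has_derivative_norm_cubed derivative_eq_intros refl)+
      (auto simp: sym[of _ "y - x"] inner_add_left fun_eq_iff)
qed

section \<open>Decrease in one cubic step\<close>

lemma cube_sum_le: "(p + q) ^ 3 \<le> 4 * (p ^ 3 + q ^ 3)" if "0 \<le> p" "0 \<le> q" for p q :: real
proof -
  have "0 \<le> 3 * (p + q) * (p - q)^2" using that by simp
  also have "\<dots> = 4 * (p ^ 3 + q ^ 3) - (p + q) ^ 3" by algebra
  finally show ?thesis by simp
qed

text \<open>The inductive step of \<open>(r\<^sub>1 + \<dots> + r\<^sub>t)^3 \<le> t^2 (r\<^sub>1^3 + \<dots> + r\<^sub>t^3)\<close>.\<close>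

lemma power_mean_step:
  fixes u r S :: real
  assumes "0 \<le> u" "0 \<le> r" "0 \<le> S" and S: "u ^ 3 \<le> real t ^ 2 * S"
  shows "(u + r) ^ 3 \<le> real (t + 1) ^ 2 * (S + r ^ 3)"
proof (cases "t = 0")
  case True
  with S have "u ^ 3 \<le> 0" by simp
  with assms(1) zero_less_power[of u 3] have "u = 0" by linarith
  with True assms show ?thesis by simp
next
  case False
  \<comment> \<open>\<open>w\<close> is the mean length of the earlier steps. Equality holds when
    all steps are equally long, hence the double root at \<open>w = r\<close> below.\<close>
  define w where "w = u / real t"
  have u: "u = real t * w" and w: "0 \<le> w" using False assms by (auto simp: w_def)
  have "real t ^ 2 * (real t * w ^ 3) \<le> real t ^ 2 * S"
    using S by (simp add: u power_mult_distrib power2_eq_square power3_eq_cube mult_ac)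
  then have "real t * w ^ 3 \<le> S" using False by simp
  moreover have "0 \<le> real t * ((w - r)^2 * ((2 * real t + 1) * w + (real t + 2) * r))"
    using w assms by simp
  moreover have "real t * ((w - r)^2 * ((2 * real t + 1) * w + (real t + 2) * r))
      = (real t + 1)^2 * (real t * w ^ 3 + r ^ 3) - (real t * w + r) ^ 3"
    by algebra
  moreover have "(real t + 1)^2 * (real t * w ^ 3 + r ^ 3) \<le> (real t + 1)^2 * (S + r ^ 3)"
    using \<open>real t * w ^ 3 \<le> S\<close> by (intro mult_left_mono) auto
  ultimately have "(real t * w + r) ^ 3 \<le> (real t + 1)^2 * (S + r ^ 3)" by linarith
  then show ?thesis by (simp add: u add.commute)
qed

text \<open>This is the bound of \<open>step_decrease\<close> in the variables \<open>a = \<sigma>^(1/2) r\<close> and \<open>b = D / \<sigma>^(1/2)\<close>.\<close>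

lemma scaled_step_decrease:
  fixes a b \<eta> :: real
  assumes "0 \<le> a" "0 \<le> b" "0 \<le> \<eta>" and \<eta>: "\<eta>^2 \<le> 41/52 * a^2 + a * b"
  shows "\<eta>^3 / 100 + 3/100 * a^3 - 11/4 * b^3 \<le> 2/13 * a^3 - a^2 * b / 2"
proof -
  \<comment> \<open>Rounding 41/52 up to 1 and adding \<open>b^2 / 4\<close> completes the
    square.\<close>
  have "\<eta>^2 \<le> (a + b/2)^2"
  proof -
    have "(a + b/2)^2 = a^2 + a * b + b^2 / 4" by (simp add: power2_eq_square power3_eq_cube field_simps)
    with \<eta> zero_le_power2[of a] zero_le_power2[of b] show ?thesis by linarith
  qed
  then have "\<eta> \<le> a + b/2" by (rule power2_le_imp_le) (use assms in simp)
  then have "\<eta>^3 \<le> (a + b/2)^3" using assms by (intro power_mono) auto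
  also have "\<dots> = a^3 + 3/2 * (a^2 * b) + 3/4 * (a * b^2) + b^3 / 8" by (simp add: power2_eq_square power3_eq_cube field_simps)
  finally have 1: "\<eta>^3 \<le> a^3 + 3/2 * (a^2 * b) + 3/4 * (a * b^2) + b^3 / 8" .
  \<comment> \<open>a cubic with a double root near the minimizer \<open>a = 3.02 b\<close> of the difference of the two sides\<close>
  have "0 \<le> (a - 16/5 * b)^2 * (a + 17/10 * b)" using assms by simp
  also have "\<dots> = a^3 - 47/10 * (a^2 * b) - 16/25 * (a * b^2) + 2176/125 * b^3" by (simp add: power2_eq_square power3_eq_cube field_simps)
  finally have 2: "0 \<le> a^3 - 47/10 * (a^2 * b) - 16/25 * (a * b^2) + 2176/125 * b^3" .
  have "0 \<le> a^3" "0 \<le> a^2 * b" "0 \<le> a * b^2" "0 \<le> b^3" using assms by simp_all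
  with 1 2 show ?thesis by linarith
qed

text \<open>With \<open>13 * L \<le> \<sigma>\<close> the coefficients depend on
  \<open>\<sigma>\<close> alone: \<open>3/4 * \<sigma> + L/2\<close> is at most
  \<open>41/52 * \<sigma>\<close>, and \<open>(\<sigma> - L) / 6\<close> is at least
  \<open>2/13 * \<sigma>\<close>. Rescaling by \<open>sqrt \<sigma>\<close> then removes
  \<open>\<sigma>\<close>.\<close>

lemma step_decrease:
  fixes \<sigma> L r D \<eta> :: real
  assumes "0 < \<sigma>" "0 \<le> r" "0 \<le> D" "0 \<le> \<eta>" and L: "13 * L \<le> \<sigma>"
    and \<eta>: "\<eta>^2 \<le> (3/4 * \<sigma> + L/2) * r^2 + D * r"
  shows "(\<eta>^3 / sqrt \<sigma>) / 100 + 3/100 * (\<sigma> * r^3) - 11/4 * (D^3 / \<sigma>^2)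
    \<le> (\<sigma> - L) / 6 * r^3 - D / 2 * r^2"
proof -
  define q where "q = sqrt \<sigma>"
  have q: "0 < q" and \<sigma>: "\<sigma> = q^2" using assms by (simp_all add: q_def)
  define a b where "a = q * r" and "b = D / q"
  have r: "r = a / q" and D: "D = b * q" using q by (simp_all add: a_def b_def)
  have "(3/4 * \<sigma> + L/2) * r^2 \<le> (41/52 * \<sigma>) * r^2"
    using L by (intro mult_right_mono) auto
  with \<eta> have "\<eta>^2 \<le> (41/52 * \<sigma>) * r^2 + D * r" by linarith
  then have "\<eta>^2 \<le> 41/52 * a^2 + a * b"
    using q by (simp add: r D \<sigma> power_divide mult.commute)
  then have "\<eta>^3 / 100 + 3/100 * a^3 - 11/4 * b^3 \<le> 2/13 * a^3 - a^2 * b / 2"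
    using assms q by (intro scaled_step_decrease) (simp_all add: a_def b_def)
  then have "(\<eta>^3 / 100 + 3/100 * a^3 - 11/4 * b^3) / q \<le> (2/13 * a^3 - a^2 * b / 2) / q"
    using q by (intro divide_right_mono) auto
  also have "(2/13 * a^3 - a^2 * b / 2) / q = 2/13 * \<sigma> * r^3 - D / 2 * r^2"
    using q by (simp add: r D \<sigma> power2_eq_square power3_eq_cube field_simps)
  also have "(\<eta>^3 / 100 + 3/100 * a^3 - 11/4 * b^3) / q
      = (\<eta>^3 / sqrt \<sigma>) / 100 + 3/100 * (\<sigma> * r^3) - 11/4 * (D^3 / \<sigma>^2)"
    using q by (simp add: r D \<sigma> power2_eq_square power3_eq_cube field_simps real_sqrt_mult)
  also have "2/13 * \<sigma> * r^3 \<le> (\<sigma> - L) / 6 * r^3"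
    using L assms by (intro mult_right_mono) auto
  finally show ?thesis by simp
qed

text \<open>\<open>step_decrease\<close> with \<open>D = \<delta> + L * u\<close>, whose cube is
  split by \<open>cube_sum_le\<close>. The \<open>\<delta>\<close> part is charged to
  \<open>E\<close>, and the \<open>u\<close> part to the stored cubes \<open>S\<close>. The two
  numerical hypotheses are what the choices of \<open>\<sigma>\<close> and \<open>h\<close>
  provide.\<close>

lemma lazy_step_decrease:
  fixes \<sigma> L m \<eta> \<delta> u S r :: real
  defines "E \<equiv> \<eta>^3 / sqrt \<sigma>"
  assumes pos: "0 < \<sigma>" "0 \<le> L" "1 \<le> m" "0 \<le> \<eta>" "0 \<le> \<delta>" "0 \<le> u" "0 \<le> r" "0 \<le> S"
    and \<sigma>: "8192 * (L^3 * m^3) \<le> 3 * \<sigma>^3"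
    and \<delta>: "65536 * \<delta>^3 \<le> E * \<sigma>^2"
    and u: "u^3 \<le> m^2 * S"
    and \<eta>: "\<eta>^2 \<le> (3/4 * \<sigma> + L/2) * r^2 + (\<delta> + L * u) * r"
  shows "E / 200 + 3/100 * (\<sigma> * r^3) - \<sigma> * S / (100 * m)
    \<le> (\<sigma> - L) / 6 * r^3 - (\<delta> + L * u) / 2 * r^2"
proof -
  \<comment> \<open>13 is the largest integer whose cube, 2197, stays below 8192/3.\<close>
  have "(13 * L)^3 \<le> \<sigma>^3"
  proof -
    have "L^3 * 1 \<le> L^3 * m^3" using pos by (intro mult_left_mono one_le_power) auto
    moreover have "0 \<le> L^3" using pos by simp
    moreover have "(13 * L)^3 = 2197 * L^3" by (simp add: power_mult_distrib)
    ultimately show ?thesis using \<sigma> by linarith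
  qed
  then have L: "13 * L \<le> \<sigma>" using pos power_mono_iff[of "13 * L" \<sigma> 3] by linarith
  have "(\<delta> + L * u)^3 \<le> 4 * (\<delta>^3 + (L * u)^3)"
    using pos by (intro cube_sum_le) auto
  also have "\<dots> \<le> 4 * (E * \<sigma>^2 / 65536 + L^3 * (m^2 * S))"
    unfolding power_mult_distrib using \<delta> u pos
    by (intro mult_left_mono add_mono) auto
  \<comment> \<open>Writing \<open>m^2\<close> as \<open>m^3 / m\<close> lets the bound on
    \<open>L^3 * m^3\<close> apply; only \<open>S / m\<close> remains, so \<open>m\<close> steps
    together cost a fixed fraction of \<open>S\<close>.\<close>
  also have "L^3 * (m^2 * S) \<le> 3 / 8192 * (\<sigma>^3 * S / m)"
  proof -
    have "L^3 * (m^2 * S) = (L^3 * m^3) * (S / m)"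
      using pos by (simp add: power2_eq_square power3_eq_cube)
    also have "\<dots> \<le> (3 / 8192 * \<sigma>^3) * (S / m)"
      using \<sigma> pos by (intro mult_right_mono) auto
    finally show ?thesis by simp
  qed
  finally have "(\<delta> + L * u)^3 \<le> 4 * (E * \<sigma>^2 / 65536 + 3 / 8192 * (\<sigma>^3 * S / m))"
    by simp
  then have "(\<delta> + L * u)^3 / \<sigma>^2 \<le> 4 * (E * \<sigma>^2 / 65536 + 3 / 8192 * (\<sigma>^3 * S / m)) / \<sigma>^2"
    using pos by (intro divide_right_mono) auto
  also have "\<dots> = 4 * (E / 65536 + 3 / 8192 * (\<sigma> * S / m))"
    using pos by (simp add: field_simps power2_eq_square power3_eq_cube)
  finally have D: "(\<delta> + L * u)^3 / \<sigma>^2 \<le> 4 * (E / 65536 + 3 / 8192 * (\<sigma> * S / m))" .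
  have "E / 100 + 3/100 * (\<sigma> * r^3) - 11/4 * ((\<delta> + L * u)^3 / \<sigma>^2)
    \<le> (\<sigma> - L) / 6 * r^3 - (\<delta> + L * u) / 2 * r^2"
    unfolding E_def using pos by (intro step_decrease L \<eta>) auto
  moreover have "0 \<le> E" using pos by (simp add: E_def)
  moreover have "0 \<le> \<sigma> * S / m" using pos by simp
  moreover have "\<sigma> * S / (100 * m) = (\<sigma> * S / m) / 100" by simp
  \<comment> \<open>The error costs 11/65536 of \<open>E\<close>, below the 1/200 given up, and
    33/8192 of \<open>W\<close>, below 1/100.\<close>
  moreover have "E / 200 + X - V \<le> Y"
    if "E / 100 + X - 11/4 * Z \<le> Y" "0 \<le> E" "0 \<le> W" "V = W / 100"
      "Z \<le> 4 * (E / 65536 + 3 / 8192 * W)" for V W X Y Z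
    using that by simp
  ultimately show ?thesis using D by blast
qed

section \<open>CubicSteps\<close>

text \<open>The objective in real arithmetic. It is faithful only on the effective domain, since
  \<open>real_of_ereal\<close> sends \<open>\<infinity>\<close> to 0.\<close>

definition real_objective :: "(real^'n \<Rightarrow> real) \<Rightarrow> (real^'n \<Rightarrow> ereal) \<Rightarrow> real^'n \<Rightarrow> real" where
  "real_objective f \<psi> x = f x + real_of_ereal (\<psi> x)"

lemma ereal_convex_part:
  assumes "proper_closed_convex \<psi>" "x \<in> effective_domain \<psi>"
  shows "ereal (real_of_ereal (\<psi> x)) = \<psi> x"
  using assms by (cases "\<psi> x") (auto simp: proper_closed_convex_def effective_domain_def)

lemma objective_eq:
  assumes "proper_closed_convex \<psi>" "x \<in> effective_domain \<psi>"
  shows "objective f \<psi> x = ereal (real_objective f \<psi> x)"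
  using ereal_convex_part[OF assms]
  by (metis objective_def plus_ereal.simps(1) real_objective_def)

context lipschitz_hessian
begin

text \<open>\<open>B\<close> is accurate at the base point, so at \<open>x\<close> it misses the
  Hessian by \<open>\<delta> + L * u\<close>. Up to this error the model agrees with the Taylor
  expansion at \<open>x\<close>, in value for the first claim and in gradient for the
  second.\<close>

lemma cubic_step_bounds:
  assumes \<psi>: "proper_closed_convex \<psi>" and x: "x \<in> effective_domain \<psi>"
    and B: "transpose B = B" "\<And>v. norm (B *v v - hessian f x\<^sub>0 *v v) \<le> \<delta> * norm v"
    and step: "cubic_step f \<psi> B \<sigma> x y s" and "0 \<le> \<sigma>"
  defines "r \<equiv> norm (y - x)" and "u \<equiv> norm (x - x\<^sub>0)"
  shows "(\<sigma> - L) / 6 * r^3 - (\<delta> + L * u) / 2 * r^2 \<le> real_objective f \<psi> x - real_objective f \<psi> y"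
    and "norm (grad f y + s) \<le> (3/4 * \<sigma> + L/2) * r^2 + (\<delta> + L * u) * r"
proof -
  define d where "d = y - x"
  have y: "y \<in> effective_domain \<psi>"
    and model: "ereal (cubic_model f B \<sigma> x y) + \<psi> y \<le> objective f \<psi> x"
    and grad_model: "norm (grad (cubic_model f B \<sigma> x) y + s) \<le> \<sigma>/4 * r^2"
    using step by (auto simp: cubic_step_def r_def)
  have r: "norm d = r" and yd: "y = x + d" by (simp_all add: d_def r_def)
  have H: "norm (hessian f x *v d - B *v d) \<le> (\<delta> + L * u) * r"
    using norm_triangle_ineq4[of "hessian f x *v d - hessian f x\<^sub>0 *v d" "B *v d - hessian f x\<^sub>0 *v d"]
      hessian_difference_bound[of x d x\<^sub>0] B(2)[of d]
    by (simp add: r u_def distrib_right)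
  have "ereal (cubic_model f B \<sigma> x y + real_of_ereal (\<psi> y)) \<le> ereal (real_objective f \<psi> x)"
    using model ereal_convex_part[OF \<psi> y] objective_eq[OF \<psi> x] by (metis plus_ereal.simps(1))
  then have M: "cubic_model f B \<sigma> x y + real_of_ereal (\<psi> y) \<le> real_objective f \<psi> x" by simp
  have "(hessian f x *v d - B *v d) \<bullet> d \<le> (\<delta> + L * u) * r * r"
    using H norm_cauchy_schwarz[of "hessian f x *v d - B *v d" d] mult_right_mono[OF H, of r]
    by (simp add: r r_def)
  then have "(hessian f x *v d) \<bullet> d \<le> (B *v d) \<bullet> d + (\<delta> + L * u) * r^2"
    by (simp add: inner_diff_left power2_eq_square mult.assoc)
  then have "f y \<le> cubic_model f B \<sigma> x y + (\<delta> + L * u) / 2 * r^2 - (\<sigma> - L) / 6 * r^3"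
    using f_taylor[of x d] unfolding cubic_model_def yd by (simp add: r field_simps)
  with M show "(\<sigma> - L) / 6 * r^3 - (\<delta> + L * u) / 2 * r^2 \<le> real_objective f \<psi> x - real_objective f \<psi> y"
    by (simp add: real_objective_def)
  \<comment> \<open>Model residual, Taylor remainder, Hessian error and cubic term. The first and
    last contribute \<open>\<sigma>/4\<close> and \<open>\<sigma>/2\<close>, hence
    \<open>3/4 * \<sigma>\<close>.\<close>
  have "grad f y + s = (grad (cubic_model f B \<sigma> x) y + s) + (grad f (x + d) - grad f x - hessian f x *v d)
      + (hessian f x *v d - B *v d) - (\<sigma> / 2 * r) *\<^sub>R d"
    by (simp add: grad_cubic_model[OF B(1)] yd r)
  also have "norm \<dots> \<le> \<sigma>/4 * r^2 + L/2 * r^2 + (\<delta> + L * u) * r + \<sigma> / 2 * r^2"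
  proof -
    have "norm (grad f (x + d) - grad f x - hessian f x *v d) \<le> L/2 * r^2"
      using grad_taylor[of x d] by (simp add: r)
    moreover have "norm ((\<sigma> / 2 * r) *\<^sub>R d) = \<sigma> / 2 * r^2"
      using \<open>0 \<le> \<sigma>\<close> by (simp add: r r_def power2_eq_square abs_mult)
    moreover have "norm (a + b + c - e) \<le> norm a + norm b + norm c + norm e" for a b c e :: "real^'n"
      using norm_triangle_ineq4[of "a + b + c" e] norm_triangle_ineq[of "a + b" c]
        norm_triangle_ineq[of a b] by linarith
    ultimately show ?thesis using grad_model H by (smt (verit))
  qed
  also have "\<dots> = (3/4 * \<sigma> + L/2) * r^2 + (\<delta> + L * u) * r" by (simp add: algebra_simps)
  finally show "norm (grad f y + s) \<le> (3/4 * \<sigma> + L/2) * r^2 + (\<delta> + L * u) * r" .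
qed

text \<open>Here \<open>S\<close> stands for the sum of the cubes of the lengths of the steps made so far.\<close>

lemma cubic_loop_not_halt:
  assumes \<psi>: "proper_closed_convex \<psi>" and x\<^sub>0: "x\<^sub>0 \<in> effective_domain \<psi>"
    and B: "transpose B = B" "\<And>v. norm (B *v v - hessian f x\<^sub>0 *v v) \<le> \<delta> * norm v"
    and pos: "0 \<le> \<delta>" "0 < \<sigma>" "0 < \<epsilon>" "m \<noteq> 0"
    and \<sigma>: "8192 * (L^3 * real m^3) \<le> 3 * \<sigma>^3"
    and \<delta>: "65536 * \<delta>^3 \<le> (\<epsilon> powr (3/2) / \<sigma> powr (1/2)) * \<sigma>^2"
    and loop: "cubic_loop f \<psi> B \<sigma> m \<epsilon> x\<^sub>0 t x P z a"
    and x: "x \<in> effective_domain \<psi>" and "t \<le> m" "0 \<le> S" "norm (x - x\<^sub>0) ^ 3 \<le> real t ^ 2 * S"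
    and "real t * (\<epsilon> powr (3/2) / \<sigma> powr (1/2) / 200) + (3/100 - real t / (100 * real m)) * (\<sigma> * S)
      \<le> real_objective f \<psi> x\<^sub>0 - real_objective f \<psi> x"
  shows "a \<noteq> Halt"
proof -
  define E where "E = \<epsilon> powr (3/2) / \<sigma> powr (1/2)"
  \<comment> \<open>Each step earns \<open>3/100 * \<sigma> * r^3\<close> and spends
    \<open>\<sigma> * S / (100 * m)\<close> of the savings, so at most \<open>m\<close> steps leave
    a coefficient of at least 2/100.\<close>
  define inv where "inv t x S \<longleftrightarrow> x \<in> effective_domain \<psi> \<and> t \<le> m \<and> 0 \<le> S \<and>
      norm (x - x\<^sub>0) ^ 3 \<le> real t ^ 2 * S \<and>
      real t * (E / 200) + (3/100 - real t / (100 * real m)) * (\<sigma> * S)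
        \<le> real_objective f \<psi> x\<^sub>0 - real_objective f \<psi> x" for t x S
  have E: "E = (sqrt \<epsilon>)^3 / sqrt \<sigma>"
  proof -
    have "\<epsilon> powr (3/2) = (\<epsilon> powr (1/2)) powr 3" by (simp add: powr_powr)
    also have "\<dots> = (sqrt \<epsilon>)^3" using pos by (simp add: powr_half_sqrt)
    finally show ?thesis using pos by (simp add: E_def powr_half_sqrt)
  qed
  have step: "inv (t + 1) y (S + norm (y - x) ^ 3)"
    if inv: "inv t x S" and "t \<noteq> m" and cs: "cubic_step f \<psi> B \<sigma> x y s"
      and eps: "\<not> norm (grad f y + s) \<le> \<epsilon>" for t x y s S
  proof -
    define r u where "r = norm (y - x)" and "u = norm (x - x\<^sub>0)"
    have x: "x \<in> effective_domain \<psi>" and t: "t + 1 \<le> m" and S: "0 \<le> S" and u: "u ^ 3 \<le> real t ^ 2 * S"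
      and dec: "real t * (E / 200) + (3/100 - real t / (100 * real m)) * (\<sigma> * S)
        \<le> real_objective f \<psi> x\<^sub>0 - real_objective f \<psi> x"
      using inv \<open>t \<noteq> m\<close> by (auto simp: inv_def u_def)
    have pos': "0 \<le> r" "0 \<le> u" "0 \<le> \<sigma>" using pos by (simp_all add: r_def u_def)
    note bounds = cubic_step_bounds[OF \<psi> x B cs pos'(3), folded r_def u_def]
    have "E / 200 + 3/100 * (\<sigma> * r^3) - \<sigma> * S / (100 * real m)
      \<le> (\<sigma> - L) / 6 * r^3 - (\<delta> + L * u) / 2 * r^2"
      unfolding E
    proof (rule lazy_step_decrease)
      have "real t ^ 2 * S \<le> real m ^ 2 * S"
        using t S by (intro mult_right_mono power_mono) auto
      with u show "u ^ 3 \<le> real m ^ 2 * S" by linarith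
      show "(sqrt \<epsilon>)\<^sup>2 \<le> (3 / 4 * \<sigma> + L / 2) * r\<^sup>2 + (\<delta> + L * u) * r"
        using bounds(2) eps pos by simp
    qed (use pos pos' S \<sigma> \<delta> L_nonneg in \<open>simp_all flip: E add: E_def\<close>)
    also note bounds(1)
    finally have "real t * (E / 200) + (3/100 - real t / (100 * real m)) * (\<sigma> * S)
        + (E / 200 + 3/100 * (\<sigma> * r^3) - \<sigma> * S / (100 * real m))
      \<le> real_objective f \<psi> x\<^sub>0 - real_objective f \<psi> y"
      using dec by linarith
    moreover have "real (t + 1) * (E / 200) + (3/100 - real (t + 1) / (100 * real m)) * (\<sigma> * (S + r^3))
        \<le> real t * (E / 200) + (3/100 - real t / (100 * real m)) * (\<sigma> * S)
          + (E / 200 + 3/100 * (\<sigma> * r^3) - \<sigma> * S / (100 * real m))"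
    proof -
      have "0 \<le> real (t + 1) / (100 * real m) * (\<sigma> * r^3)"
        using pos pos' by simp
      then show ?thesis by (simp add: distrib_left distrib_right left_diff_distrib add_divide_distrib)
    qed
    moreover have "norm (y - x\<^sub>0) ^ 3 \<le> real (t + 1) ^ 2 * (S + r ^ 3)"
    proof -
      have "norm (y - x\<^sub>0) \<le> u + r"
        using norm_triangle_ineq[of "x - x\<^sub>0" "y - x"] by (simp add: u_def r_def)
      then have "norm (y - x\<^sub>0) ^ 3 \<le> (u + r) ^ 3" by (intro power_mono) auto
      with power_mean_step[OF pos'(2,1) S u] show ?thesis by linarith
    qed
    ultimately show ?thesis
      using cs t S pos' unfolding inv_def by (auto simp: cubic_step_def r_def)
  qed
  \<comment> \<open>For \<open>t \<le> m\<close> the term in \<open>\<sigma> * S\<close> is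
    nonnegative and may be dropped; the remaining 1/200 exceeds the 1/384 of the test.\<close>
  have no_halt: "objective f \<psi> x\<^sub>0 - objective f \<psi> y
      \<ge> ereal (\<epsilon> powr (3/2) / (384 * \<sigma> powr (1/2)) * real t)" if "inv t y S" for t y S
  proof -
    have "real t / (100 * real m) \<le> 3/100" using that pos by (simp add: inv_def field_simps)
    then have "0 \<le> (3/100 - real t / (100 * real m)) * (\<sigma> * S)"
      using that pos unfolding inv_def by (intro mult_nonneg_nonneg) auto
    moreover have "0 \<le> real t * E" using pos by (simp add: E_def)
    ultimately have "E / 384 * real t \<le> real_objective f \<psi> x\<^sub>0 - real_objective f \<psi> y"
    proof -
      have "c * w / 384 \<le> z" if "0 \<le> v" "0 \<le> w * c" "w * (c / 200) + v \<le> z" for c v w z :: real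
        using that by (simp add: mult.commute)
      from this[OF \<open>0 \<le> (3/100 - _) * _\<close> \<open>0 \<le> real t * E\<close>] that show ?thesis
        unfolding inv_def times_divide_eq_left by blast
    qed
    then show ?thesis
      using that unfolding inv_def by (simp add: objective_eq[OF \<psi>] x\<^sub>0 E_def)
  qed
  have "inv t x S" using assms by (simp add: inv_def E_def)
  with loop show ?thesis
  proof (induction arbitrary: S rule: cubic_loop.induct)
    case (continue t x y s P z a)
    then show ?case using step by blast
  next
    case (halt t x y s)
    then show ?case using step no_halt by blast
  qed simp_all
qed

section \<open>First-order optimality\<close>

text \<open>On the segment from \<open>x\<close> to \<open>y\<close>, convexity bounds the growth of
  \<open>\<psi>\<close> linearly, so minimality bounds the slope of \<open>f\<close> from below.
  Letting \<open>t\<close> tend to 0 from the right gives the subgradient inequality.\<close>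

lemma minimizer_stationary:
  assumes \<psi>: "proper_closed_convex \<psi>" and x: "x \<in> effective_domain \<psi>"
    and min: "\<And>y. y \<in> effective_domain \<psi> \<Longrightarrow> real_objective f \<psi> x \<le> real_objective f \<psi> y"
  shows "- grad f x \<in> subdifferential \<psi> x"
proof -
  let ?p = "\<lambda>y. real_of_ereal (\<psi> y)"
  have "\<psi> x + ereal (- grad f x \<bullet> (y - x)) \<le> \<psi> y" for y
  proof (cases "y \<in> effective_domain \<psi>")
    case True
    have slope: "?p x - ?p y \<le> (f (x + t *\<^sub>R (y - x)) - f x) / t" if t: "0 < t" "t < 1" for t
    proof -
      let ?z = "x + t *\<^sub>R (y - x)"
      have "(x, ?p x) \<in> extended_epigraph \<psi>" "(y, ?p y) \<in> extended_epigraph \<psi>"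
        using ereal_convex_part[OF \<psi>] x True by (simp_all add: extended_epigraph_def)
      then have "(1 - t) *\<^sub>R (x, ?p x) + t *\<^sub>R (y, ?p y) \<in> extended_epigraph \<psi>"
        using \<psi> t by (intro convexD) (auto simp: proper_closed_convex_def)
      then have z: "\<psi> ?z \<le> ereal ((1 - t) * ?p x + t * ?p y)"
        by (simp add: extended_epigraph_def algebra_simps)
      then have zd: "?z \<in> effective_domain \<psi>"
        unfolding effective_domain_def using le_less_trans by fastforce
      with z have "?p ?z \<le> (1 - t) * ?p x + t * ?p y"
        using ereal_convex_part[OF \<psi> zd] by (metis ereal_less_eq(3))
      with min[OF zd] have "t * (?p x - ?p y) \<le> f ?z - f x"
        by (simp add: real_objective_def algebra_simps)
      then show ?thesis using t by (simp add: field_simps)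
    qed
    have "((\<lambda>t. (f (x + t *\<^sub>R (y - x)) - f x) / t) \<longlongrightarrow> grad f x \<bullet> (y - x)) (at 0)"
      using f_has_real_derivative[of x "y - x" 0] by (simp add: DERIV_def)
    then have "((\<lambda>t. (f (x + t *\<^sub>R (y - x)) - f x) / t) \<longlongrightarrow> grad f x \<bullet> (y - x)) (at_right 0)"
      by (rule tendsto_mono[OF at_le[OF subset_UNIV]])
    moreover have "eventually (\<lambda>t. ?p x - ?p y \<le> (f (x + t *\<^sub>R (y - x)) - f x) / t) (at_right 0)"
      unfolding eventually_at_right[OF zero_less_one] using slope by (intro exI[of _ 1]) auto
    ultimately have "?p x - ?p y \<le> grad f x \<bullet> (y - x)"
      by (rule tendsto_lowerbound) simp
    then have "ereal (?p x) + ereal (- grad f x \<bullet> (y - x)) \<le> ereal (?p y)" by simp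
    then show ?thesis using ereal_convex_part[OF \<psi>] x True by simp
  qed (simp add: effective_domain_def)
  with x show ?thesis by (simp add: subdifferential_def)
qed

end

section \<open>Outcomes of CubicSteps\<close>

lemma cubic_loop_length:
  "cubic_loop f \<psi> B \<sigma> m \<epsilon> x\<^sub>0 t x P z a \<Longrightarrow> t \<le> m \<Longrightarrow> length P \<le> m - t"
  by (induction rule: cubic_loop.induct) auto

lemma cubic_loop_domain:
  "cubic_loop f \<psi> B \<sigma> m \<epsilon> x\<^sub>0 t x P z a \<Longrightarrow> x \<in> effective_domain \<psi> \<Longrightarrow> z \<in> effective_domain \<psi>"
  by (induction rule: cubic_loop.induct) (auto simp: cubic_step_def)

lemma cubic_loop_solution:
  "cubic_loop f \<psi> B \<sigma> m \<epsilon> x\<^sub>0 t x P z a \<Longrightarrow> a = Solution \<Longrightarrow> eps_stationary f \<psi> \<epsilon> z"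
  by (induction rule: cubic_loop.induct) (auto simp: cubic_step_def eps_stationary_def)

text \<open>The last hypothesis is a loop invariant: after a continued step it is the decrease test
  just passed, and at the exit \<open>t = m\<close> it is the conclusion.\<close>

lemma cubic_loop_success:
  assumes "cubic_loop f \<psi> B \<sigma> m \<epsilon> x\<^sub>0 t x P z a" "a = Success"
    and "ereal (\<epsilon> powr (3/2) / (384 * \<sigma> powr (1/2)) * real t) \<le> objective f \<psi> x\<^sub>0 - objective f \<psi> x"
  shows "ereal (\<epsilon> powr (3/2) / (384 * \<sigma> powr (1/2)) * real m) \<le> objective f \<psi> x\<^sub>0 - objective f \<psi> z"
  using assms by (induction rule: cubic_loop.induct) auto

section \<open>The choices of the regularization parameter and the difference step\<close>

lemma root_cubed: "(c powr (1/3)) ^ 3 = c" if "0 < c" for c :: real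
  using that by (simp add: powr_powr flip: powr_numeral)

lemma powr_three_halves: "c powr (3/2) = sqrt c ^ 3" if "0 \<le> c" for c :: real
proof -
  have "c powr (3/2) = (c powr (1/2)) powr 3" by (simp add: powr_powr)
  then show ?thesis using that by (simp add: powr_half_sqrt)
qed

lemma reg_param_pos: "0 < \<theta> \<Longrightarrow> m \<noteq> 0 \<Longrightarrow> 0 < reg_param \<theta> m"
  by (simp add: reg_param_def)

text \<open>For \<open>L \<le> \<theta>\<close> this yields the condition on \<open>\<sigma>\<close>
  in \<open>lazy_step_decrease\<close>, with equality at \<open>\<theta> = L\<close>.\<close>

lemma reg_param_cubed: "3 * reg_param \<theta> m ^ 3 = 8192 * (\<theta> ^ 3 * real m ^ 3)"
  using root_cubed[of "2/3"] by (simp add: reg_param_def power_mult_distrib)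

lemma fd_step_pos: "0 < n \<Longrightarrow> 0 < \<theta> \<Longrightarrow> m \<noteq> 0 \<Longrightarrow> 0 < \<epsilon> \<Longrightarrow> 0 < fd_step n \<theta> m \<epsilon>"
  using reg_param_pos[of \<theta> m] by (simp add: fd_step_def)

text \<open>The constant is \<open>3 / (2^7 * 192) = 1/8192\<close>. It fits the condition on
  \<open>\<delta>\<close>: the factor 1/2 in the Hessian error turns 65536 into 8192 when
  cubed.\<close>

lemma fd_step_cubed:
  assumes "0 < n" "0 < \<theta>" "m \<noteq> 0" "0 < \<epsilon>"
  shows "(sqrt (real n) * fd_step n \<theta> m \<epsilon> * \<theta>) ^ 3 = (sqrt (reg_param \<theta> m) * sqrt \<epsilon>) ^ 3 / 8192"
proof -
  have \<sigma>: "0 < reg_param \<theta> m" using assms by (simp add: reg_param_pos)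
  then have "fd_step n \<theta> m \<epsilon> ^ 3
      = 3 * sqrt (reg_param \<theta> m) ^ 3 * sqrt \<epsilon> ^ 3 / (2^7 * 192 * sqrt (real n) ^ 3 * \<theta> ^ 3)"
    using assms unfolding fd_step_def by (subst root_cubed) (simp_all add: powr_three_halves)
  then show ?thesis using assms by (simp add: power_mult_distrib)
qed

text \<open>The loop starts at the base point with no steps stored, so its invariant holds with
  \<open>t = 0\<close> and \<open>S = 0\<close>. Both parameters are designed for
  \<open>\<theta>\<close> in place of the unknown \<open>L\<close>, and
  \<open>L \<le> \<theta>\<close> makes them safe.\<close>

lemma (in lipschitz_hessian) cubic_steps_not_halt:
  assumes \<psi>: "proper_closed_convex \<psi>" and x: "x \<in> effective_domain \<psi>"
    and \<theta>: "0 < \<theta>" "L \<le> \<theta>" and \<epsilon>: "0 < \<epsilon>" and m: "m \<noteq> 0"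
    and run: "cubic_steps f \<psi> x (fd_hessian f x (fd_step CARD('n) \<theta> m \<epsilon>)) (reg_param \<theta> m) m \<epsilon> P z a"
  shows "a \<noteq> Halt"
proof -
  define \<sigma> h where "\<sigma> = reg_param \<theta> m" and "h = fd_step CARD('n) \<theta> m \<epsilon>"
  define \<delta> where "\<delta> = L * h / 2 * sqrt (real CARD('n))"
  have \<sigma>: "0 < \<sigma>" and h: "0 < h"
    using \<theta> \<epsilon> m by (simp_all add: \<sigma>_def h_def reg_param_pos fd_step_pos)
  have L3: "L ^ 3 \<le> \<theta> ^ 3" using \<theta> L_nonneg by (intro power_mono) auto
  show ?thesis
  proof (rule cubic_loop_not_halt[OF \<psi> x, where S = 0])
    show "transpose (fd_hessian f x h) = fd_hessian f x h" by (rule transpose_fd_hessian)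
    show "norm (fd_hessian f x h *v v - hessian f x *v v) \<le> \<delta> * norm v" for v
      unfolding \<delta>_def using h by (rule fd_hessian_error)
    show "cubic_loop f \<psi> (fd_hessian f x h) \<sigma> m \<epsilon> x 0 x P z a"
      using run by (simp add: cubic_steps_def \<sigma>_def h_def)
    show "8192 * (L ^ 3 * real m ^ 3) \<le> 3 * \<sigma> ^ 3"
      using L3 by (simp add: \<sigma>_def reg_param_cubed mult_right_mono)
    show "65536 * \<delta> ^ 3 \<le> \<epsilon> powr (3 / 2) / \<sigma> powr (1 / 2) * \<sigma>\<^sup>2"
    proof -
      have "65536 * \<delta> ^ 3 = 8192 * (L ^ 3 * (sqrt (real CARD('n)) * h) ^ 3)"
        by (simp add: \<delta>_def power_mult_distrib power_divide)
      also have "\<dots> \<le> 8192 * (\<theta> ^ 3 * (sqrt (real CARD('n)) * h) ^ 3)"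
        using L3 h by (intro mult_left_mono mult_right_mono) auto
      also have "\<dots> = (sqrt \<sigma> * sqrt \<epsilon>) ^ 3"
        using fd_step_cubed[of "CARD('n)" \<theta> m \<epsilon>] \<theta> \<epsilon> m
        by (simp add: h_def \<sigma>_def power_mult_distrib mult_ac)
      also have "\<dots> = sqrt \<epsilon> ^ 3 / sqrt \<sigma> * (sqrt \<sigma> ^ 2) ^ 2"
      proof -
        have "(q * e) ^ 3 = e ^ 3 / q * (q ^ 2) ^ 2" if "0 < q" for q e :: real
          using that by (simp add: power2_eq_square power3_eq_cube)
        then show ?thesis using \<sigma> by (simp only: real_sqrt_gt_zero)
      qed
      finally show ?thesis
        using \<sigma> \<epsilon> by (simp add: powr_three_halves powr_half_sqrt)
    qed
  qed (use \<sigma> h x \<epsilon> m L_nonneg in \<open>auto simp: \<delta>_def\<close>)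
qed

section \<open>Runs of the algorithm\<close>

lemma iteration_started_Suc:
  "iteration_started \<alpha> (Suc k) \<longleftrightarrow> iteration_started \<alpha> k \<and> (\<exists>l. ends_at \<alpha> k l \<and> \<alpha> k l = Success)"
  by (auto simp: iteration_started_def less_Suc_eq)

lemma iteration_started_generated: "iteration_started \<alpha> k \<Longrightarrow> iterate_generated \<alpha> k"
  by (cases k) (auto simp: iterate_generated_def iteration_started_Suc)

lemma Least_not_Halt: "ends_at \<alpha> k l \<Longrightarrow> (LEAST l. \<alpha> k l \<noteq> Halt) = l"
  by (rule Least_equality) (auto simp: ends_at_def inner_reached_def not_less[symmetric])

lemma INF_enat_eq_Least: "Q k \<Longrightarrow> (INF k\<in>{k. Q k}. enat k) = enat (LEAST k. Q k)"
  by (intro antisym INF_lower INF_greatest) (auto intro: LeastI Least_le)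

lemma size_oracle_queries:
  fixes x :: "real^'n"
  shows "size (oracle_queries x h P) = 2 + CARD('n) + length P"
  by (simp add: oracle_queries_def)

text \<open>Source of the constants in the final bound: 16 and the factor 2 from doubling give
  \<open>2^5\<close>, and the square root halves all exponents.\<close>

lemma reg_param_powr_half_le:
  assumes "0 < \<theta>" "\<theta> \<le> 2 * M" "m \<noteq> 0"
  shows "reg_param \<theta> m powr (1/2) \<le> 2 powr (5/2) * (2/3) powr (1/6) * M powr (1/2) * sqrt (real m)"
proof -
  have "reg_param \<theta> m = (16 * (2/3) powr (1/3) * real m) * \<theta>"
    by (simp add: reg_param_def)
  also have "\<dots> \<le> (16 * (2/3) powr (1/3) * real m) * (2 * M)"
    using assms by (intro mult_left_mono) auto
  also have "\<dots> = 2 powr 5 * (2/3) powr (1/3) * M * real m" by simp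
  finally have "reg_param \<theta> m powr (1/2) \<le> (2 powr 5 * (2/3) powr (1/3) * M * real m) powr (1/2)"
    using assms reg_param_pos[of \<theta> m] by (intro powr_mono2) auto
  also have "\<dots> = 2 powr (5/2) * (2/3) powr (1/6) * M powr (1/2) * sqrt (real m)"
  proof -
    have "(a * b * c * d) powr (1/2) = a powr (1/2) * b powr (1/2) * c powr (1/2) * sqrt d"
      if "0 \<le> a" "0 \<le> b" "0 \<le> c" "0 \<le> d" for a b c d :: real
      using that by (simp add: real_sqrt_mult powr_half_sqrt)
    moreover have "(2 powr 5) powr (1/2) = (2::real) powr (5/2)"
      "((2/3) powr (1/3)) powr (1/2) = (2/3 :: real) powr (1/6)"
      by (simp_all only: powr_powr) simp_all
    ultimately show ?thesis using assms by simp
  qed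
  finally show ?thesis .
qed

lemma log_trial_le:
  fixes a b :: real
  assumes "0 < a" "0 < b" "2^l * a \<le> 2 * b"
  shows "real l + log 2 a \<le> 1 + log 2 b"
proof -
  have "log 2 (2^l * a) \<le> log 2 (2 * b)" using assms by (intro log_mono) auto
  then show ?thesis using assms by (simp add: log_mult log_nat_power)
qed

locale CNM_run = lipschitz_hessian f L
  for f :: "real^'n \<Rightarrow> real" and L :: real +
  fixes \<psi> :: "real^'n \<Rightarrow> ereal" and \<tau>\<^sub>0 \<epsilon> :: real and m :: nat and x\<^sub>0 :: "real^'n"
    and x :: "nat \<Rightarrow> real^'n" and \<tau> :: "nat \<Rightarrow> real"
    and xh :: "nat \<Rightarrow> nat \<Rightarrow> real^'n" and \<alpha> :: "nat \<Rightarrow> nat \<Rightarrow> outcome"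
    and P :: "nat \<Rightarrow> nat \<Rightarrow> (real^'n) list"
  assumes \<psi>: "proper_closed_convex \<psi>" and bounded: "optimal_value f \<psi> > -\<infinity>"
    and x\<^sub>0: "x\<^sub>0 \<in> effective_domain \<psi>" and \<tau>\<^sub>0: "0 < \<tau>\<^sub>0" and \<epsilon>: "0 < \<epsilon>" and m: "m \<noteq> 0"
    and run: "first_order_CNM_run f \<psi> x\<^sub>0 \<tau>\<^sub>0 \<epsilon> m x \<tau> xh \<alpha> P"
begin

definition \<tau>\<^sub>m\<^sub>a\<^sub>x :: real where "\<tau>\<^sub>m\<^sub>a\<^sub>x = max \<tau>\<^sub>0 L"

text \<open>The decrease tested in CubicSteps at \<open>t + 1 = m\<close>, with the regularization
  parameter at its largest possible value. Its reciprocal times \<open>gap\<close> is the bound on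
  the stopping index.\<close>

definition min_decrease :: real where
  "min_decrease = \<epsilon> powr (3/2) * sqrt (real m)
     / (384 * (2 powr (5/2) * (2/3) powr (1/6) * \<tau>\<^sub>m\<^sub>a\<^sub>x powr (1/2)))"

definition gap :: real where
  "gap = real_of_ereal (objective f \<psi> x\<^sub>0 - optimal_value f \<psi>)"

lemma \<tau>\<^sub>m\<^sub>a\<^sub>x: "0 < \<tau>\<^sub>m\<^sub>a\<^sub>x" "\<tau>\<^sub>0 \<le> \<tau>\<^sub>m\<^sub>a\<^sub>x" "L \<le> \<tau>\<^sub>m\<^sub>a\<^sub>x"
  using \<tau>\<^sub>0 by (auto simp: \<tau>\<^sub>m\<^sub>a\<^sub>x_def)

lemma min_decrease_pos: "0 < min_decrease"
  using \<tau>\<^sub>m\<^sub>a\<^sub>x \<epsilon> m by (simp add: min_decrease_def)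

lemma run_cubic_steps:
  assumes "iteration_started \<alpha> k" "inner_reached \<alpha> k l"
  shows "cubic_steps f \<psi> (x k) (fd_hessian f (x k) (fd_step CARD('n) (2^l * \<tau> k) m \<epsilon>))
    (reg_param (2^l * \<tau> k) m) m \<epsilon> (P k l) (xh k l) (\<alpha> k l)"
  using run assms by (simp add: first_order_CNM_run_def)

lemma run_ends_at:
  assumes "iteration_started \<alpha> k" "ends_at \<alpha> k l"
  shows "x (Suc k) = xh k l"
    and "\<alpha> k l = Success \<Longrightarrow> \<tau> (Suc k) = max \<tau>\<^sub>0 (2^l * \<tau> k / 2)"
  using run assms by (simp_all add: first_order_CNM_run_def power_int_diff)

text \<open>Unless \<open>l = 0\<close>, the previous trial halted, so half the current trial value
  lies below \<open>L\<close>.\<close>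

lemma trial_parameter_le:
  assumes k: "iteration_started \<alpha> k" and x: "x k \<in> effective_domain \<psi>"
    and \<tau>: "0 < \<tau> k" "\<tau> k \<le> \<tau>\<^sub>m\<^sub>a\<^sub>x" and l: "inner_reached \<alpha> k l"
  shows "2^l * \<tau> k \<le> 2 * \<tau>\<^sub>m\<^sub>a\<^sub>x"
proof (cases l)
  case 0
  with \<tau> \<tau>\<^sub>m\<^sub>a\<^sub>x show ?thesis by simp
next
  case (Suc j)
  then have j: "inner_reached \<alpha> k j" "\<alpha> k j = Halt" using l by (auto simp: inner_reached_def)
  have "\<not> L \<le> 2^j * \<tau> k"
    using cubic_steps_not_halt[OF \<psi> x _ _ \<epsilon> m run_cubic_steps[OF k j(1)]] \<tau> j(2) by auto
  then show ?thesis using Suc \<tau>\<^sub>m\<^sub>a\<^sub>x by simp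
qed

text \<open>The last conjunct counts inner iterations: iteration \<open>k\<close> has at most
  \<open>2 + log 2 (\<tau> (Suc k) / \<tau> k)\<close> of them, and the logarithms
  telescope.\<close>

lemma iteration_invariant:
  assumes "iteration_started \<alpha> k"
  shows "x k \<in> effective_domain \<psi> \<and> \<tau>\<^sub>0 \<le> \<tau> k \<and> \<tau> k \<le> \<tau>\<^sub>m\<^sub>a\<^sub>x \<and>
    real k * min_decrease \<le> real_objective f \<psi> x\<^sub>0 - real_objective f \<psi> (x k) \<and>
    (\<Sum>j<k. real (LEAST l. \<alpha> j l \<noteq> Halt) + 1) \<le> 2 * real k + log 2 (\<tau> k / \<tau>\<^sub>0)"
  using assms
proof (induction k)
  case 0
  then show ?case using run x\<^sub>0 \<tau>\<^sub>0 \<tau>\<^sub>m\<^sub>a\<^sub>x by (simp add: first_order_CNM_run_def)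
next
  case (Suc k)
  obtain l where k: "iteration_started \<alpha> k" and l: "ends_at \<alpha> k l" "\<alpha> k l = Success"
    using Suc.prems by (auto simp: iteration_started_Suc)
  have x: "x k \<in> effective_domain \<psi>" and \<tau>: "\<tau>\<^sub>0 \<le> \<tau> k" "\<tau> k \<le> \<tau>\<^sub>m\<^sub>a\<^sub>x" "0 < \<tau> k"
    and dec: "real k * min_decrease \<le> real_objective f \<psi> x\<^sub>0 - real_objective f \<psi> (x k)"
    and sum: "(\<Sum>j<k. real (LEAST l. \<alpha> j l \<noteq> Halt) + 1) \<le> 2 * real k + log 2 (\<tau> k / \<tau>\<^sub>0)"
    using Suc.IH[OF k] \<tau>\<^sub>0 by auto
  have reached: "inner_reached \<alpha> k l" using l by (simp add: ends_at_def)
  note trial = trial_parameter_le[OF k x \<tau>(3,2) reached]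
  have x': "x (Suc k) = xh k l" and \<tau>': "\<tau> (Suc k) = max \<tau>\<^sub>0 (2^l * \<tau> k / 2)"
    using run_ends_at[OF k l(1)] l(2) by auto
  note loop = run_cubic_steps[OF k reached, unfolded cubic_steps_def]
  have xd: "x (Suc k) \<in> effective_domain \<psi>"
    using cubic_loop_domain[OF loop x] x' by simp
  define \<sigma> where "\<sigma> = reg_param (2^l * \<tau> k) m"
  have \<sigma>: "0 < \<sigma>" using \<tau> m by (simp add: \<sigma>_def reg_param_pos)
  have "min_decrease \<le> \<epsilon> powr (3/2) / (384 * \<sigma> powr (1/2)) * real m"
  proof -
    define K where "K = 2 powr (5/2) * (2/3) powr (1/6) * \<tau>\<^sub>m\<^sub>a\<^sub>x powr (1/2)"
    have K: "0 < K" using \<tau>\<^sub>m\<^sub>a\<^sub>x by (simp add: K_def)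
    have "\<sigma> powr (1/2) \<le> K * sqrt (real m)"
      unfolding \<sigma>_def K_def using \<tau> m trial by (intro reg_param_powr_half_le) auto
    then have "\<epsilon> powr (3/2) / (384 * (K * sqrt (real m))) * real m
        \<le> \<epsilon> powr (3/2) / (384 * \<sigma> powr (1/2)) * real m"
      using \<sigma> K m by (intro mult_right_mono divide_left_mono) auto
    \<comment> \<open>\<open>m\<close> steps gain a factor \<open>m\<close>, while the root of the
      regularization parameter loses \<open>sqrt m\<close>.\<close>
    also have "\<epsilon> powr (3/2) / (384 * (K * sqrt (real m))) * real m = min_decrease"
    proof -
      have "e / (384 * (K * s)) * (s * s) = e * s / (384 * K)" if "0 < s" for e s :: real
        using that K by simp
      from this[of "sqrt (real m)"] show ?thesis
        using m by (simp add: min_decrease_def K_def)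
    qed
    finally show ?thesis .
  qed
  moreover have "ereal (\<epsilon> powr (3/2) / (384 * \<sigma> powr (1/2)) * real m)
      \<le> objective f \<psi> (x k) - objective f \<psi> (x (Suc k))"
    using cubic_loop_success[OF loop l(2)] x objective_eq[OF \<psi> x] unfolding x' \<sigma>_def by simp
  then have "\<epsilon> powr (3/2) / (384 * \<sigma> powr (1/2)) * real m
      \<le> real_objective f \<psi> (x k) - real_objective f \<psi> (x (Suc k))"
    by (simp add: objective_eq[OF \<psi>] x xd)
  ultimately have "real (Suc k) * min_decrease \<le> real_objective f \<psi> x\<^sub>0 - real_objective f \<psi> (x (Suc k))"
    using dec by (simp add: distrib_right)
  moreover have "\<tau>\<^sub>0 \<le> \<tau> (Suc k)" "\<tau> (Suc k) \<le> \<tau>\<^sub>m\<^sub>a\<^sub>x"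
    using \<tau>' trial \<tau>\<^sub>m\<^sub>a\<^sub>x by auto
  moreover have "(\<Sum>j<Suc k. real (LEAST l. \<alpha> j l \<noteq> Halt) + 1)
      \<le> 2 * real (Suc k) + log 2 (\<tau> (Suc k) / \<tau>\<^sub>0)"
  proof -
    have "real l + log 2 (\<tau> k / \<tau>\<^sub>0) \<le> 1 + log 2 (\<tau> (Suc k) / \<tau>\<^sub>0)"
    proof (rule log_trial_le)
      \<comment> \<open>The maximum in the update can only raise \<open>\<tau>\<close> above
        \<open>2^l * \<tau> k / 2\<close>.\<close>
      show "2^l * (\<tau> k / \<tau>\<^sub>0) \<le> 2 * (\<tau> (Suc k) / \<tau>\<^sub>0)"
        using \<tau>' \<tau>\<^sub>0 by (simp add: field_simps)
    qed (use \<tau> \<tau>\<^sub>0 \<tau>' in auto)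
    then show ?thesis using sum Least_not_Halt[OF l(1)] by simp
  qed
  ultimately show ?case using xd by blast
qed

section \<open>Termination\<close>

text \<open>Endless halting would double the trial value past the bound of
  \<open>trial_parameter_le\<close>.\<close>

lemma inner_loop_ends:
  assumes k: "iteration_started \<alpha> k"
  shows "\<exists>l. ends_at \<alpha> k l"
proof (rule ccontr)
  assume never: "\<nexists>l. ends_at \<alpha> k l"
  have reached: "inner_reached \<alpha> k l" for l
  proof (induction l)
    case (Suc l)
    with never have "\<alpha> k l = Halt" by (auto simp: ends_at_def)
    with Suc show ?case by (auto simp: inner_reached_def less_Suc_eq)
  qed (simp add: inner_reached_def)
  have \<tau>: "0 < \<tau> k" using iteration_invariant[OF k] \<tau>\<^sub>0 by auto
  obtain l where "2 * \<tau>\<^sub>m\<^sub>a\<^sub>x / \<tau> k < 2 ^ l" using real_arch_pow[of 2] by auto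
  moreover have "2^l * \<tau> k \<le> 2 * \<tau>\<^sub>m\<^sub>a\<^sub>x"
    using trial_parameter_le[OF k _ \<tau> _ reached] iteration_invariant[OF k] by auto
  ultimately show False using \<tau> by (simp add: field_simps)
qed

text \<open>The infimum is finite, bounded above by the value at \<open>x\<^sub>0\<close>, so
  \<open>real_of_ereal\<close> in \<open>gap\<close> does not fall back on its default
  value.\<close>

lemma optimal_value_lower:
  assumes "y \<in> effective_domain \<psi>"
  shows "real_objective f \<psi> x\<^sub>0 - real_objective f \<psi> y \<le> gap"
proof -
  have le: "optimal_value f \<psi> \<le> ereal (real_objective f \<psi> z)" if "z \<in> effective_domain \<psi>" for z
    unfolding optimal_value_def using that by (auto intro!: INF_lower2 simp: objective_eq[OF \<psi>])
  obtain v where v: "optimal_value f \<psi> = ereal v"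
    using bounded le[OF x\<^sub>0] by (cases "optimal_value f \<psi>") auto
  show ?thesis using le[OF assms] by (simp add: gap_def v objective_eq[OF \<psi> x\<^sub>0])
qed

text \<open>Equality would make \<open>y\<close> a minimizer, at which the subgradient
  \<open>- grad f y\<close> gives residual 0. Strictness is what the rounded bound rests on.\<close>

lemma less_gap:
  assumes y: "y \<in> effective_domain \<psi>" and "\<not> eps_stationary f \<psi> \<epsilon> y"
  shows "real_objective f \<psi> x\<^sub>0 - real_objective f \<psi> y < gap"
proof (rule ccontr)
  assume "\<not> ?thesis"
  then have "real_objective f \<psi> y \<le> real_objective f \<psi> z" if "z \<in> effective_domain \<psi>" for z
    using optimal_value_lower[OF that] by simp
  from minimizer_stationary[OF \<psi> y this] have "eps_stationary f \<psi> \<epsilon> y"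
    using \<epsilon> by (auto simp: eps_stationary_def intro!: bexI[of _ "- grad f y"])
  with assms show False by simp
qed

text \<open>Infinitely many successes would exceed \<open>gap\<close>, so some started iteration is
  the last one.\<close>

lemma run_terminates: "\<exists>k. iterate_generated \<alpha> k \<and> eps_stationary f \<psi> \<epsilon> (x k)"
proof -
  have "\<exists>k. iteration_started \<alpha> k \<and> \<not> iteration_started \<alpha> (Suc k)"
  proof (rule ccontr)
    assume "\<not> ?thesis"
    then have started: "iteration_started \<alpha> k" for k
    proof (induction k)
      case 0
      show ?case by (simp add: iteration_started_def)
    qed blast
    obtain k :: nat where "gap < real k * min_decrease"
      using reals_Archimedean3[OF min_decrease_pos] by auto
    with iteration_invariant[OF started[of k]] optimal_value_lower[of "x k"] show False by auto
  qed
  then obtain k where k: "iteration_started \<alpha> k" "\<not> iteration_started \<alpha> (Suc k)" by auto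
  obtain l where l: "ends_at \<alpha> k l" using inner_loop_ends[OF k(1)] by auto
  \<comment> \<open>\<open>Halt\<close> is excluded by \<open>ends_at\<close>, and
    \<open>Success\<close> would start the next iteration.\<close>
  then have "\<alpha> k l = Solution" "inner_reached \<alpha> k l"
    using k by (cases "\<alpha> k l"; auto simp: iteration_started_Suc ends_at_def)+
  then have "eps_stationary f \<psi> \<epsilon> (x (Suc k))"
    using cubic_loop_solution[OF run_cubic_steps[OF k(1), unfolded cubic_steps_def]]
      run_ends_at(1)[OF k(1) l] by simp
  moreover have "iterate_generated \<alpha> (Suc k)"
    using k l by (auto simp: iterate_generated_def)
  ultimately show ?thesis by auto
qed

section \<open>Counting oracle calls\<close>

text \<open>If iteration \<open>T - 1\<close> ends with \<open>Solution\<close>,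
  \<open>\<tau> T\<close> is unconstrained. The invariant is therefore used up to
  \<open>T - 1\<close>, and the last inner loop is bounded through
  \<open>trial_parameter_le\<close>.\<close>

lemma inner_iterations_le:
  assumes T: "iterate_generated \<alpha> T"
  shows "(\<Sum>j<T. real (LEAST l. \<alpha> j l \<noteq> Halt) + 1) \<le> 2 * real T + log 2 (\<tau>\<^sub>m\<^sub>a\<^sub>x / \<tau>\<^sub>0)"
proof (cases T)
  case 0
  then show ?thesis using \<tau>\<^sub>0 \<tau>\<^sub>m\<^sub>a\<^sub>x by simp
next
  case (Suc k)
  then obtain l where k: "iteration_started \<alpha> k" and l: "ends_at \<alpha> k l"
    using T by (auto simp: iterate_generated_def)
  have inv: "x k \<in> effective_domain \<psi>" "0 < \<tau> k" "\<tau> k \<le> \<tau>\<^sub>m\<^sub>a\<^sub>x"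
    using iteration_invariant[OF k] \<tau>\<^sub>0 by auto
  have "real l + log 2 (\<tau> k / \<tau>\<^sub>0) \<le> 1 + log 2 (\<tau>\<^sub>m\<^sub>a\<^sub>x / \<tau>\<^sub>0)"
  proof (rule log_trial_le)
    show "2^l * (\<tau> k / \<tau>\<^sub>0) \<le> 2 * (\<tau>\<^sub>m\<^sub>a\<^sub>x / \<tau>\<^sub>0)"
      using trial_parameter_le[OF k inv] l \<tau>\<^sub>0 by (simp add: ends_at_def divide_simps)
  qed (use inv \<tau>\<^sub>0 \<tau>\<^sub>m\<^sub>a\<^sub>x in auto)
  then show ?thesis using iteration_invariant[OF k] Least_not_Halt[OF l] Suc by simp
qed

lemma oracle_calls_le:
  assumes T: "iterate_generated \<alpha> T"
  shows "real (oracle_calls \<epsilon> m x \<tau> \<alpha> P T)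
    \<le> (2 + real CARD('n) + real m) * (2 * real T + log 2 (\<tau>\<^sub>m\<^sub>a\<^sub>x / \<tau>\<^sub>0))"
proof -
  have started: "iteration_started \<alpha> k" if "k < T" for k
    using T that by (cases T) (auto simp: iterate_generated_def iteration_started_def)
  have "length (P k l) \<le> m" if "k < T" "l \<le> (LEAST l. \<alpha> k l \<noteq> Halt)" for k l
  proof -
    \<comment> \<open>All trials before the least non-halting one halted, so the points in
      \<open>P k l\<close> come from an executed call.\<close>
    have "inner_reached \<alpha> k l"
      unfolding inner_reached_def
    proof (intro allI impI)
      fix j assume "j < l"
      with that(2) have "j < (LEAST l. \<alpha> k l \<noteq> Halt)" by linarith
      from not_less_Least[OF this] show "\<alpha> k j = Halt" by simp
    qed
    from cubic_loop_length[OF run_cubic_steps[OF started this, unfolded cubic_steps_def]] that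
    show ?thesis by simp
  qed
  then have "oracle_calls \<epsilon> m x \<tau> \<alpha> P T
      \<le> (\<Sum>k<T. \<Sum>l\<le>(LEAST l. \<alpha> k l \<noteq> Halt). 2 + CARD('n) + m)"
    unfolding oracle_calls_def size_oracle_queries by (intro sum_mono) auto
  also have "real \<dots> = (2 + real CARD('n) + real m) * (\<Sum>k<T. real (LEAST l. \<alpha> k l \<noteq> Halt) + 1)"
    by (simp add: sum_distrib_left algebra_simps)
  also have "\<dots> \<le> (2 + real CARD('n) + real m) * (2 * real T + log 2 (\<tau>\<^sub>m\<^sub>a\<^sub>x / \<tau>\<^sub>0))"
    by (intro mult_left_mono inner_iterations_le T) auto
  finally show ?thesis by simp
qed

end

theorem theorem4p5:
  fixes f :: "real^'n \<Rightarrow> real" and \<psi> :: "real^'n \<Rightarrow> ereal"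
    and L \<tau>\<^sub>0 \<epsilon> :: real and m :: nat and x\<^sub>0 :: "real^'n"
    and x :: "nat \<Rightarrow> real^'n" and \<tau> :: "nat \<Rightarrow> real"
    and xh :: "nat \<Rightarrow> nat \<Rightarrow> real^'n" and \<alpha> :: "nat \<Rightarrow> nat \<Rightarrow> outcome"
    and P :: "nat \<Rightarrow> nat \<Rightarrow> (real^'n) list"
  assumes "twice_continuously_differentiable f"
    and "proper_closed_convex \<psi>"
    and "optimal_value f \<psi> > -\<infinity>"
    and "L \<ge> 0"
    and "\<And>u v. spectral_norm (hessian f v - hessian f u) \<le> L * norm (v - u)"
    and "x\<^sub>0 \<in> effective_domain \<psi>" and "\<tau>\<^sub>0 > 0" and "\<epsilon> > 0" and "m \<noteq> 0"
    and "first_order_CNM_run f \<psi> x\<^sub>0 \<tau>\<^sub>0 \<epsilon> m x \<tau> xh \<alpha> P"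
  shows "\<exists>T::nat. stopping_index f \<psi> \<epsilon> x \<alpha> = enat T \<and>
    (let n = CARD('n);
         C = 384 * 2 powr (5/2) * (2/3) powr (1/6) * (max \<tau>\<^sub>0 L) powr (1/2)
               * real_of_ereal (objective f \<psi> x\<^sub>0 - optimal_value f \<psi>);
         R = C / sqrt (real m) * \<epsilon> powr (-3/2);
         FO = real (oracle_calls \<epsilon> m x \<tau> \<alpha> P T);
         D = (2 + real n + real m) * log 2 (max \<tau>\<^sub>0 L / \<tau>\<^sub>0)
     in (iteration_started \<alpha> T \<longrightarrow>
           real T \<le> R \<and>
           FO \<le> (5 + 2 * (real n + real m)) / sqrt (real m) * C * \<epsilon> powr (-3/2) + D) \<and>
        int T \<le> \<lceil>R\<rceil> \<and>
        FO \<le> (5 + 2 * (real n + real m)) * real_of_int \<lceil>R\<rceil> + D)"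
proof -
  interpret CNM_run f L \<psi> \<tau>\<^sub>0 \<epsilon> m x\<^sub>0 x \<tau> xh \<alpha> P
    using assms by unfold_locales (auto simp: twice_continuously_differentiable_def)
  define Q where "Q k \<longleftrightarrow> iterate_generated \<alpha> k \<and> eps_stationary f \<psi> \<epsilon> (x k)" for k
  define T where "T = (LEAST k. Q k)"
  define C where "C = 384 * 2 powr (5/2) * (2/3) powr (1/6) * (max \<tau>\<^sub>0 L) powr (1/2)
               * real_of_ereal (objective f \<psi> x\<^sub>0 - optimal_value f \<psi>)"
  define R where "R = C / sqrt (real m) * \<epsilon> powr (-3/2)"
  define D where "D = (2 + real CARD('n) + real m) * log 2 (max \<tau>\<^sub>0 L / \<tau>\<^sub>0)"
  define FO where "FO = real (oracle_calls \<epsilon> m x \<tau> \<alpha> P T)"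
  have ex: "\<exists>k. Q k" using run_terminates by (simp add: Q_def)
  then have stop: "stopping_index f \<psi> \<epsilon> x \<alpha> = enat T"
    unfolding stopping_index_def T_def Q_def[symmetric] using INF_enat_eq_Least by metis
  have T: "iterate_generated \<alpha> T" using LeastI_ex[OF ex] by (simp add: T_def Q_def)
  have R: "R = gap / min_decrease"
    using \<epsilon> m by (simp add: R_def C_def gap_def min_decrease_def \<tau>\<^sub>m\<^sub>a\<^sub>x_def powr_minus divide_simps)
  have started: "real T \<le> R" if "iteration_started \<alpha> T"
  proof -
    have "real T * min_decrease \<le> gap"
      using iteration_invariant[OF that] optimal_value_lower[of "x T"] by auto
    then show ?thesis using min_decrease_pos by (simp add: R field_simps)
  qed
  have ceil: "int T \<le> \<lceil>R\<rceil>"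
  proof (cases "iteration_started \<alpha> T")
    case True
    then show ?thesis using started by linarith
  next
    case False
    then obtain k where k: "T = Suc k"
      by (cases T) (auto simp: iteration_started_def)
    then have k': "iteration_started \<alpha> k" using T by (simp add: iterate_generated_def)
    \<comment> \<open>Minimality of \<open>T\<close>; since \<open>x k\<close> was generated, it
      must fail to be stationary.\<close>
    have "\<not> Q k" using k not_less_Least[of k Q] by (simp add: T_def)
    then have "\<not> eps_stationary f \<psi> \<epsilon> (x k)"
      using iteration_started_generated[OF k'] by (simp add: Q_def)
    then have "real k * min_decrease < gap"
      using iteration_invariant[OF k'] less_gap[of "x k"] by auto
    then have "real k < R" using min_decrease_pos by (simp add: R field_simps)
    then show ?thesis using k by linarith
  qed
  have FO: "FO \<le> (5 + 2 * (real CARD('n) + real m)) * r + D" if "real T \<le> r" for r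
  proof -
    have "FO \<le> (4 + 2 * (real CARD('n) + real m)) * real T + D"
      using oracle_calls_le[OF T] unfolding FO_def D_def \<tau>\<^sub>m\<^sub>a\<^sub>x_def by (simp add: algebra_simps)
    \<comment> \<open>Twice the cost \<open>2 + n + m\<close> gives 4, so the claimed 5 leaves
      slack.\<close>
    also have "(4 + 2 * (real CARD('n) + real m)) * real T \<le> (5 + 2 * (real CARD('n) + real m)) * r"
      using that by (intro mult_mono) auto
    finally show ?thesis by simp
  qed
  have "FO \<le> (5 + 2 * (real CARD('n) + real m)) / sqrt (real m) * C * \<epsilon> powr (-3/2) + D"
    if "iteration_started \<alpha> T"
    using FO[OF started[OF that]] by (simp add: R_def)
  moreover have "FO \<le> (5 + 2 * (real CARD('n) + real m)) * real_of_int \<lceil>R\<rceil> + D"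
    using FO[of "real_of_int \<lceil>R\<rceil>"] ceil by linarith
  ultimately show ?thesis
    using stop started ceil unfolding Let_def FO_def D_def R_def C_def by blast
qed

end
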